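(* The map $\Phi:\mathcal{B}\to\mathcal{B}'$ defined by $\Phi((q_0,q_1))=(\mu(q_0,q_1),\alpha(q_0,q_1))$ is bijective. Moreover, the inverse map $\Phi^{-1}$ is continuous in $\mathcal{B}'$.
   Context: $\mathbb{N}=\{1,2,\dots\}$, $\mathbb{N}_0=\mathbb{N}\cup\{0\}$. $\Sigma_2=\{0,1\}^{\mathbb{N}}$; $\Sigma_2^0$ and $\Sigma_2^1$ are the sets of sequences $(d_i)\in\Sigma_2$ with $d_1=0$ and $d_1=1$, respectively. $\sigma((d_i))=(d_{i+1})$ is the left shift. $\prec,\preccurlyeq,\succ,\succcurlyeq$ refer to the lexicographic order. For a finite word $w$, $w^\infty$ is its infinite repetition. A sequence $(d_i)\in\Sigma_2$ is finite if there is $K\in\mathbb{N}$ with $d_K=1$ and $d_k=0$ for all $k>K$, and infinite otherwise; it is co-finite if $(1-d_i)$ is finite, and co-infinite otherwise (so $0^\infty$ and $1^\infty$ are both infinite and co-infinite). For $(q_0,q_1)\in(1,\infty)^2$ with $q_0+q_1\ge q_0q_1$, a double-base expansion of a real number $x$ is a sequence $(d_i)\in\Sigma_2$ with $$x=\pi_{q_0,q_1}((d_i)):=\sum_{i=1}^\infty\frac{d_i}{q_{d_1}q_{d_2}\cdots q_{d_i}}.$$ Put $\ell_{q_0,q_1}=\frac{q_1}{q_0(q_1-1)}-1$ and $r_{q_0,q_1}=\frac{q_0}{q_1}$. Let $\mu(q_0,q_1)$ (quasi-lazy expansion) be the lexicographically smallest co-infinite double-base expansion of $\ell_{q_0,q_1}$,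 and $\alpha(q_0,q_1)$ (quasi-greedy expansion) the lexicographically largest infinite double-base expansion of $r_{q_0,q_1}$. Define $$\mathcal{B}=\{(q_0,q_1)\in(1,\infty)^2: q_0+q_1>q_0q_1\}.$$ Let $\mathcal{C}'$ be the set of pairs $(\mu,\alpha)\in\Sigma_2^0\times\Sigma_2^1$ such that $\mu=0^\infty$, or $\mu=x_1\cdots x_m1^\infty$ for some $m\in\mathbb{N}$, $x_i\in\{0,1\}$, $x_m=0$, or $\alpha=1^\infty$, or $\alpha=y_1\cdots y_n0^\infty$ for some $n\in\mathbb{N}$, $y_j\in\{0,1\}$, $y_n=1$. Define $$\mathcal{B}'=\{(\mu,\alpha)\in(\Sigma_2^0\times\Sigma_2^1)\setminus\mathcal{C}':\ \mu\preccurlyeq\sigma^m(\mu)\text{ and }\sigma^n(\alpha)\preccurlyeq\alpha\text{ for all }m,n\in\mathbb{N}_0\}.$$ $\Sigma_2$ carries the metric $d((c_i),(e_i))=2^{-j}$ with $j=\min\{i:c_i\ne e_i\}$ if $(c_i)\neq(e_i)$, and $0$ otherwise; $\Sigma_2\times\Sigma_2$ carries the max of the two coordinate metrics; $\mathbb{R}^2$ carries the max metric. $\mathcal{B}$ and $\mathcal{B}'$ have the subspace topologies. *)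

theory Defs
  imports "HOL-Analysis.Analysis" "HOL-Library.Fun_Lexorder"
begin

text \<open>
  A sequence \<open>(d\<^sub>1, d\<^sub>2, \<dots>)\<close> of digits in \<open>{0, 1}\<close> is represented by \<open>d :: nat \<Rightarrow> bool\<close>, where
  \<open>d i\<close> stands for the digit \<open>d\<^sub>i\<^sub>+\<^sub>1\<close> and \<open>False\<close>, \<open>True\<close> stand for \<open>0\<close>, \<open>1\<close>. As
  \<open>False < True\<close>, the relation \<open>less_fun\<close> is the lexicographic order.
\<close>

type_synonym binseq = "nat \<Rightarrow> bool"

definition Sigma2_0 :: "binseq set" where
  "Sigma2_0 = {d. \<not> d 0}"

definition Sigma2_1 :: "binseq set" where
  "Sigma2_1 = {d. d 0}"

definition shift :: "binseq \<Rightarrow> binseq" where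
  "shift d = (\<lambda>i. d (Suc i))"

definition lex_le :: "binseq \<Rightarrow> binseq \<Rightarrow> bool"  (infix "\<preceq>\<^sub>l" 50) where
  "c \<preceq>\<^sub>l e \<longleftrightarrow> less_fun c e \<or> c = e"

definition finite_seq :: "binseq \<Rightarrow> bool" where
  "finite_seq d \<longleftrightarrow> (\<exists>K. d K \<and> (\<forall>k>K. \<not> d k))"

definition cofinite_seq :: "binseq \<Rightarrow> bool" where
  "cofinite_seq d \<longleftrightarrow> finite_seq (\<lambda>i. \<not> d i)"

definition const_seq :: "bool \<Rightarrow> binseq" where
  "const_seq b = (\<lambda>i. b)"

definition append_seq :: "bool list \<Rightarrow> binseq \<Rightarrow> binseq" where
  "append_seq w d = (\<lambda>i. if i < length w then w ! i else d (i - length w))"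


definition base :: "real \<Rightarrow> real \<Rightarrow> bool \<Rightarrow> real" where
  "base q0 q1 b = (if b then q1 else q0)"

definition expansion_value :: "real \<Rightarrow> real \<Rightarrow> binseq \<Rightarrow> real" where
  "expansion_value q0 q1 d = (\<Sum>i. of_bool (d i) / (\<Prod>j\<le>i. base q0 q1 (d j)))"

definition is_expansion :: "real \<Rightarrow> real \<Rightarrow> real \<Rightarrow> binseq \<Rightarrow> bool" where
  "is_expansion q0 q1 x d \<longleftrightarrow> x = expansion_value q0 q1 d"

definition ell :: "real \<Rightarrow> real \<Rightarrow> real" where
  "ell q0 q1 = q1 / (q0 * (q1 - 1)) - 1"

definition rr :: "real \<Rightarrow> real \<Rightarrow> real" where
  "rr q0 q1 = q0 / q1"

definition is_quasi_lazy :: "real \<Rightarrow> real \<Rightarrow> real \<Rightarrow> binseq \<Rightarrow> bool" where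
  "is_quasi_lazy q0 q1 x d \<longleftrightarrow>
     is_expansion q0 q1 x d \<and> \<not> cofinite_seq d \<and>
     (\<forall>e. is_expansion q0 q1 x e \<and> \<not> cofinite_seq e \<longrightarrow> d \<preceq>\<^sub>l e)"

definition is_quasi_greedy :: "real \<Rightarrow> real \<Rightarrow> real \<Rightarrow> binseq \<Rightarrow> bool" where
  "is_quasi_greedy q0 q1 x d \<longleftrightarrow>
     is_expansion q0 q1 x d \<and> \<not> finite_seq d \<and>
     (\<forall>e. is_expansion q0 q1 x e \<and> \<not> finite_seq e \<longrightarrow> e \<preceq>\<^sub>l d)"

definition mu :: "real \<Rightarrow> real \<Rightarrow> binseq" where
  "mu q0 q1 = (THE d. is_quasi_lazy q0 q1 (ell q0 q1) d)"

definition alpha :: "real \<Rightarrow> real \<Rightarrow> binseq" where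
  "alpha q0 q1 = (THE d. is_quasi_greedy q0 q1 (rr q0 q1) d)"


definition B :: "(real \<times> real) set" where
  "B = {(q0, q1). q0 > 1 \<and> q1 > 1 \<and> q0 + q1 > q0 * q1}"

definition C' :: "(binseq \<times> binseq) set" where
  "C' = {(m, a) \<in> Sigma2_0 \<times> Sigma2_1.
     m = const_seq False \<or>
     (\<exists>w. w \<noteq> [] \<and> last w = False \<and> m = append_seq w (const_seq True)) \<or>
     a = const_seq True \<or>
     (\<exists>w. w \<noteq> [] \<and> last w = True \<and> a = append_seq w (const_seq False))}"

definition B' :: "(binseq \<times> binseq) set" where
  "B' = {(m, a) \<in> (Sigma2_0 \<times> Sigma2_1) - C'.
     (\<forall>k. m \<preceq>\<^sub>l (shift ^^ k) m) \<and> (\<forall>n. (shift ^^ n) a \<preceq>\<^sub>l a)}"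

definition Phi :: "real \<times> real \<Rightarrow> binseq \<times> binseq" where
  "Phi = (\<lambda>(q0, q1). (mu q0 q1, alpha q0 q1))"


text \<open>The exponent is a successor because positions are counted from \<open>1\<close> in the metric.\<close>

definition seq_dist :: "binseq \<Rightarrow> binseq \<Rightarrow> real" where
  "seq_dist c e = (if c = e then 0 else (1 / 2) ^ Suc (LEAST i. c i \<noteq> e i))"

definition max_dist ::
    "('a \<Rightarrow> 'a \<Rightarrow> real) \<Rightarrow> ('b \<Rightarrow> 'b \<Rightarrow> real) \<Rightarrow> 'a \<times> 'b \<Rightarrow> 'a \<times> 'b \<Rightarrow> real" where
  "max_dist d1 d2 = (\<lambda>(x, y) (x', y'). max (d1 x x') (d2 y y'))"

definition seq_pair_topology :: "(binseq \<times> binseq) topology" where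
  "seq_pair_topology = Metric_space.mtopology UNIV (max_dist seq_dist seq_dist)"

definition plane_topology :: "(real \<times> real) topology" where
  "plane_topology = Metric_space.mtopology UNIV (max_dist dist dist)"

lemma Metric_space_seq_dist: "Metric_space UNIV seq_dist"
proof
  show "0 \<le> seq_dist x y" for x y
    by (simp add: seq_dist_def)
  show "seq_dist x y = seq_dist y x" for x y
    by (simp add: seq_dist_def eq_commute[of "x i" "y i" for i] eq_commute[of x y])
  show "seq_dist x y = 0 \<longleftrightarrow> x = y" for x y
    by (simp add: seq_dist_def)
  show "seq_dist x z \<le> seq_dist x y + seq_dist y z" for x y z
  proof (cases "x = y \<or> y = z \<or> x = z")
    case True
    then show ?thesis by (auto simp: seq_dist_def)
  next
    case False
    define n where "n = (LEAST i. x i \<noteq> z i)"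
    have n: "x n \<noteq> z n"
      unfolding n_def by (rule LeastI_ex) (use False in auto)
    have le: "(1 / 2) ^ Suc n \<le> seq_dist c e" if "c n \<noteq> e n" for c e
    proof -
      have "(LEAST i. c i \<noteq> e i) \<le> n"
        using that by (rule Least_le)
      then have "(1 / 2 :: real) ^ Suc n \<le> (1 / 2) ^ Suc (LEAST i. c i \<noteq> e i)"
        by (intro power_decreasing) auto
      then show ?thesis
        using that by (auto simp: seq_dist_def)
    qed
    have nonneg: "0 \<le> seq_dist c e" for c e
      by (simp add: seq_dist_def)
    have "seq_dist x z = (1 / 2) ^ Suc n"
      using False by (simp add: seq_dist_def n_def)
    moreover have "x n \<noteq> y n \<or> y n \<noteq> z n"
      using n by auto
    ultimately show ?thesis
      using le[of x y] le[of y z] nonneg[of x y] nonneg[of y z] by linarith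
  qed
qed

lemma Metric_space_max_dist:
  assumes "Metric_space UNIV d1" and "Metric_space UNIV d2"
  shows "Metric_space UNIV (max_dist d1 d2)"
proof -
  interpret M1: Metric_space UNIV d1 by fact
  interpret M2: Metric_space UNIV d2 by fact
  show ?thesis
  proof
    show "0 \<le> max_dist d1 d2 x y" for x y
      by (auto simp: max_dist_def split: prod.splits intro: max.coboundedI1)
    show "max_dist d1 d2 x y = max_dist d1 d2 y x" for x y
      by (auto simp: max_dist_def M1.commute M2.commute split: prod.splits)
    show "max_dist d1 d2 x y = 0 \<longleftrightarrow> x = y" for x y
    proof (cases x, cases y)
      fix a b a' b' assume xy: "x = (a, b)" "y = (a', b')"
      have "max (d1 a a') (d2 b b') = 0 \<longleftrightarrow> d1 a a' = 0 \<and> d2 b b' = 0"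
        using M1.nonneg[of a a'] M2.nonneg[of b b'] by linarith
      then show ?thesis by (simp add: max_dist_def xy)
    qed
    show "max_dist d1 d2 x z \<le> max_dist d1 d2 x y + max_dist d1 d2 y z" for x y z
    proof (cases x, cases y, cases z)
      fix a b a' b' a'' b'' assume xyz: "x = (a, b)" "y = (a', b')" "z = (a'', b'')"
      show ?thesis
        using M1.triangle[of a a' a''] M2.triangle[of b b' b'']
        by (simp add: max_dist_def xyz) linarith
    qed
  qed
qed

end

theory Submission
  imports Defs
begin

text \<open>
  Everything is read off a normalized value. Multiplying by \<open>q1 - 1\<close> turns the expansion map into
  \<open>h = nvalue q0 q1\<close> with values in \<open>[0, 1]\<close>, and prefixing a digit acts by
  \<open>x \<mapsto> x / q0\<close> (digit 0) or \<open>x \<mapsto> 1 - (1 - x) / q1\<close> (digit 1). Two facts become visible. Exchanging the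
  digits and the bases replaces \<open>h\<close> by \<open>1 - h\<close> (\<open>nvalue_flip\<close>), so quasi-lazy expansions of
  \<open>ell\<close> are mirror images of quasi-greedy expansions of \<open>rr\<close> and only the latter need to be studied.
  And \<open>h\<close> is decreasing in \<open>q0\<close> and increasing in \<open>q1\<close> (\<open>nvalue_mono\<close>), whereas the
  expansion value \<open>h / (q1 - 1)\<close> itself is decreasing in both bases.

  Since \<open>\<alpha>\<close> starts with 1 and \<open>\<mu>\<close> with 0, being expansions of \<open>rr\<close> and \<open>ell\<close> means
  \<open>h (shift \<alpha>) = p = 1 - h (shift \<mu>)\<close> with \<open>p = (q0 - 1) * (q1 - 1)\<close>; this is the predicate
  \<open>solves\<close>. On \<open>B\<close> the number \<open>p\<close> is less than 1, and a Parry type argument shows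
  that a sequence satisfying the first equation is the quasi-greedy expansion exactly if it
  starts with 1, is infinite, different from \<open>1\<^sup>\<infinity>\<close> and not exceeded by its shifts (\<open>quasi_greedy_rr_iff\<close>). Hence
  \<open>Phi (q0, q1) = (\<mu>, \<alpha>)\<close> iff \<open>(\<mu>, \<alpha>) \<in> B'\<close> and the two equations hold
  (\<open>Phi_eq_iff\<close>), and the theorem says that for \<open>(\<mu>, \<alpha>) \<in> B'\<close> the two equations have a unique solution
  in \<open>B\<close>, which depends continuously on \<open>(\<mu>, \<alpha>)\<close>.

  For uniqueness and continuity, a solution is viewed as a common zero of \<open>balance_sum\<close>, which is strictly
  increasing in both bases, and of \<open>balance_diff\<close>, which is strictly decreasing in \<open>q0\<close> and strictly
  increasing in \<open>q1\<close>. Knowing the signs of both functions at a point \<open>c\<close> therefore excludes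
  solutions from two of the four closed quadrants at \<open>c\<close>. Take the four points that differ from a
  given solution by \<open>\<delta>\<close> in one coordinate: the excluded quadrants together cover everything outside
  a square of side \<open>2 * \<delta>\<close>. The signs at these four points do not change when \<open>\<mu>\<close> and \<open>\<alpha>\<close> are
  altered far out, so the solution for nearby sequences stays in the square
  (\<open>solution_stable\<close>). Uniqueness is the case of equal sequences.

  For existence, on each hyperbola \<open>(q0 - 1) * (q1 - 1) = p\<close> with \<open>0 < p \<le> 1\<close>
  the function \<open>balance_diff\<close> has exactly one zero,
  which moves continuously with \<open>p\<close>. Following it, \<open>h (shift \<alpha>) - p\<close> is negative at \<open>p = 1\<close>, because
  \<open>h < 1\<close>, and positive for small \<open>p\<close> (\<open>nvalue_exceeds_product\<close>); the intermediate value theorem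
  yields the solution (\<open>solution_exists\<close>).
\<close>

section \<open>The normalized value of a sequence\<close>

definition flip :: "binseq \<Rightarrow> binseq" where
  "flip d = (\<lambda>i. \<not> d i)"

text \<open>
  This rescales the expansion interval \<open>[0, 1 / (q1 - 1)]\<close> to the unit interval, which makes the roles of
  the two digits symmetric.
\<close>

definition nvalue :: "real \<Rightarrow> real \<Rightarrow> binseq \<Rightarrow> real" where
  "nvalue q0 q1 d = (q1 - 1) * expansion_value q0 q1 d"

text \<open>
  The supremum \<open>M\<close> of \<open>X\<close> satisfies \<open>M \<le> c * max 0 M + \<delta>\<close>. With \<open>\<delta> = 0\<close> this turns a one-step recursion
  for the difference of two functions of sequences into equality or comparison of these functions.
\<close>

lemma contraction_bound:
  fixes X :: "'s \<Rightarrow> real"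
  assumes c: "0 \<le> c" "c < 1" and \<delta>: "0 \<le> \<delta>"
    and bdd: "\<And>s. X s \<le> K"
    and step: "\<And>s. \<exists>t. X s \<le> c * max 0 (X t) + \<delta>"
  shows "X s \<le> \<delta> / (1 - c)"
proof -
  define K' where "K' = max 0 K"
  have K': "0 \<le> K'" "\<And>s. X s \<le> K'"
    using bdd by (auto simp: K'_def le_max_iff_disj)
  have fix_pt: "c * (\<delta> / (1 - c)) + \<delta> = \<delta> / (1 - c)"
    using c by (simp add: field_simps)
  have iter: "X s \<le> c ^ n * K' + \<delta> / (1 - c)" for n s
  proof (induction n arbitrary: s)
    case 0
    have "0 \<le> \<delta> / (1 - c)" using c \<delta> by simp
    then show ?case using K'(2)[of s] by simp
  next
    case (Suc n)
    obtain t where t: "X s \<le> c * max 0 (X t) + \<delta>" using step by blast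
    have "0 \<le> c ^ n * K' + \<delta> / (1 - c)" using c \<delta> K' by simp
    then have "max 0 (X t) \<le> c ^ n * K' + \<delta> / (1 - c)" using Suc.IH[of t] by simp
    then have "c * max 0 (X t) \<le> c * (c ^ n * K' + \<delta> / (1 - c))"
      using c by (intro mult_left_mono)
    with t fix_pt show ?case by (simp add: algebra_simps)
  qed
  have "(\<lambda>n. c ^ n * K' + \<delta> / (1 - c)) \<longlonglongrightarrow> 0 * K' + \<delta> / (1 - c)"
    using c by (intro tendsto_intros LIMSEQ_power_zero) auto
  then show ?thesis using iter by (intro LIMSEQ_le_const) auto
qed

lemma funpow_shift: "(shift ^^ n) d i = d (i + n)"
  by (induction n arbitrary: i) (auto simp: shift_def)

lemma shift_apply: "shift d i = d (Suc i)"
  by (simp add: shift_def)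

lemma flip_apply: "flip d i \<longleftrightarrow> \<not> d i"
  by (simp add: flip_def)

lemma flip_flip [simp]: "flip (flip d) = d"
  by (simp add: flip_def)

lemma flip_shift: "shift (flip d) = flip (shift d)"
  by (simp add: shift_def flip_def)

lemma flip_funpow_shift: "(shift ^^ n) (flip d) = flip ((shift ^^ n) d)"
  by (rule ext) (simp add: funpow_shift flip_apply)

lemma prod_base_ge:
  assumes "1 < q0" "1 < q1"
  shows "min q0 q1 ^ n \<le> (\<Prod>j<n. base q0 q1 (d j))"
proof -
  have "(\<Prod>j<n. min q0 q1) \<le> (\<Prod>j<n. base q0 q1 (d j))"
    using assms by (intro prod_mono) (auto simp: base_def)
  then show ?thesis by simp
qed

lemma prod_base_pos:
  assumes "1 < q0" "1 < q1" shows "0 < (\<Prod>j\<in>A. base q0 q1 (d j))"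
  using assms by (intro prod_pos) (auto simp: base_def)

lemma summable_expansion:
  assumes q: "1 < q0" "1 < q1"
  shows "summable (\<lambda>i. of_bool (d i) / (\<Prod>j\<le>i. base q0 q1 (d j)))"
proof (rule summable_comparison_test')
  show "summable (\<lambda>i. (1 / min q0 q1) ^ Suc i)"
    unfolding summable_Suc_iff using q by (intro summable_geometric) auto
  fix i
  have "min q0 q1 ^ Suc i \<le> (\<Prod>j\<le>i. base q0 q1 (d j))"
    using prod_base_ge[OF q, of "Suc i" d] by (simp only: lessThan_Suc_atMost)
  moreover have "0 < min q0 q1 ^ Suc i" using q by (intro zero_less_power) auto
  ultimately have "1 / (\<Prod>j\<le>i. base q0 q1 (d j)) \<le> 1 / min q0 q1 ^ Suc i"
    by (intro divide_left_mono mult_pos_pos) auto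
  then show "norm (of_bool (d i) / (\<Prod>j\<le>i. base q0 q1 (d j))) \<le> (1 / min q0 q1) ^ Suc i"
    using prod_base_pos[OF q, of d "{..i}"] q by (auto simp: power_one_over)
qed

lemma expansion_value_rec:
  assumes q: "1 < q0" "1 < q1"
  shows "expansion_value q0 q1 d =
    (of_bool (d 0) + expansion_value q0 q1 (shift d)) / base q0 q1 (d 0)"
proof -
  let ?f = "\<lambda>d i. of_bool (d i) / (\<Prod>j\<le>i. base q0 q1 (d j))"
  have tail: "?f d (Suc i) = ?f (shift d) i / base q0 q1 (d 0)" for i
    by (simp add: prod.atMost_Suc_shift shift_apply del: prod.atMost_Suc)
  have "expansion_value q0 q1 d = ?f d 0 + (\<Sum>i. ?f d (Suc i))"
    unfolding expansion_value_def using suminf_split_head[OF summable_expansion[OF q, of d]] by simp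
  also have "(\<Sum>i. ?f d (Suc i)) = (\<Sum>i. ?f (shift d) i) / base q0 q1 (d 0)"
    unfolding tail by (rule suminf_divide[OF summable_expansion[OF q]])
  finally show ?thesis
    by (simp add: expansion_value_def add_divide_distrib)
qed

lemma expansion_value_nonneg:
  assumes q: "1 < q0" "1 < q1"
  shows "0 \<le> expansion_value q0 q1 d"
  unfolding expansion_value_def using less_imp_le[OF prod_base_pos[OF q]]
  by (intro suminf_nonneg summable_expansion q) auto

lemma expansion_value_antimono:
  assumes q: "1 < q0" "1 < q1" "q0 \<le> q0'" "q1 \<le> q1'"
  shows "expansion_value q0' q1' d \<le> expansion_value q0 q1 d"
  unfolding expansion_value_def
proof (rule suminf_le)
  fix i
  have "(\<Prod>j\<le>i. base q0 q1 (d j)) \<le> (\<Prod>j\<le>i. base q0' q1' (d j))"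
    using q by (intro prod_mono) (auto simp: base_def)
  then show "of_bool (d i) / (\<Prod>j\<le>i. base q0' q1' (d j)) \<le> of_bool (d i) / (\<Prod>j\<le>i. base q0 q1 (d j))"
    using prod_base_pos[of q0 q1 d "{..i}"] prod_base_pos[of q0' q1' d "{..i}"] q
    by (intro divide_left_mono) auto
qed (use q in \<open>auto intro: summable_expansion\<close>)

text \<open>
  The bound is the value of \<open>1\<^sup>\<infinity>\<close>, the fixed point of prefixing the digit 1, and prefixing 0 to a
  sequence does not exceed it either.
\<close>

lemma expansion_value_le:
  assumes q: "1 < q0" "1 < q1"
  shows "expansion_value q0 q1 d \<le> 1 / (q1 - 1)"
proof -
  define m where "m = min q0 q1"
  have m: "1 < m" "m \<le> q0" "m \<le> q1" using q by (auto simp: m_def)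
  have bdd: "expansion_value q0 q1 d - 1 / (q1 - 1) \<le> (\<Sum>i. (1 / m) ^ Suc i)" for d
  proof -
    have "expansion_value q0 q1 d \<le> expansion_value m m d"
      using m by (intro expansion_value_antimono) auto
    also have "\<dots> \<le> (\<Sum>i. (1 / m) ^ Suc i)"
      unfolding expansion_value_def
    proof (rule suminf_le)
      show "of_bool (d i) / (\<Prod>j\<le>i. base m m (d j)) \<le> (1 / m) ^ Suc i" for i
      proof -
        have "(\<Prod>j\<le>i. base m m (d j)) = m ^ Suc i" by (simp add: base_def)
        then show ?thesis using m by (auto simp: power_one_over)
      qed
      show "summable (\<lambda>i. (1 / m) ^ Suc i)"
        unfolding summable_Suc_iff using m by (intro summable_geometric) auto
      show "summable (\<lambda>i. of_bool (d i) / (\<Prod>j\<le>i. base m m (d j)))"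
        using m(1,1) by (rule summable_expansion)
    qed
    moreover have "0 \<le> 1 / (q1 - 1)" using q by simp
    ultimately show ?thesis by linarith
  qed
  have "expansion_value q0 q1 d - 1 / (q1 - 1) \<le> 0 / (1 - 1 / m)"
  proof (rule contraction_bound[where X = "\<lambda>d. expansion_value q0 q1 d - 1 / (q1 - 1)", OF _ _ _ bdd])
    fix d
    define y where "y = expansion_value q0 q1 (shift d) - 1 / (q1 - 1)"
    have "expansion_value q0 q1 d - 1 / (q1 - 1) \<le> y / base q0 q1 (d 0)"
    proof (cases "d 0")
      case True
      have "(1 + 1 / (q1 - 1)) / q1 = 1 / (q1 - 1)" using q by (simp add: field_simps)
      then show ?thesis
        using True unfolding expansion_value_rec[OF q, of d] y_def
        by (simp add: base_def add_divide_distrib diff_divide_distrib)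
    next
      case False
      have "1 / (q1 - 1) / q0 \<le> 1 / (q1 - 1) / 1"
        using q by (intro divide_left_mono) auto
      then show ?thesis
        using False unfolding expansion_value_rec[OF q, of d] y_def
        by (simp add: base_def diff_divide_distrib)
    qed
    also have "\<dots> \<le> max 0 y / base q0 q1 (d 0)"
      using q by (intro divide_right_mono) (auto simp: base_def)
    also have "\<dots> \<le> max 0 y / m"
      using m by (intro divide_left_mono) (auto simp: base_def)
    finally show "\<exists>t. expansion_value q0 q1 d - 1 / (q1 - 1)
        \<le> 1 / m * max 0 (expansion_value q0 q1 t - 1 / (q1 - 1)) + 0"
      unfolding y_def by auto
  qed (use m in simp_all)
  then show ?thesis by simp
qed

lemma nvalue_0:
  assumes "1 < q0" "1 < q1" "\<not> d 0"
  shows "nvalue q0 q1 d = nvalue q0 q1 (shift d) / q0"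
  using assms expansion_value_rec[of q0 q1 d] by (simp add: nvalue_def base_def)

lemma nvalue_1:
  assumes "1 < q0" "1 < q1" "d 0"
  shows "nvalue q0 q1 d = 1 - (1 - nvalue q0 q1 (shift d)) / q1"
  using assms expansion_value_rec[of q0 q1 d] by (simp add: nvalue_def base_def field_simps)

lemma nvalue_nonneg: "1 < q0 \<Longrightarrow> 1 < q1 \<Longrightarrow> 0 \<le> nvalue q0 q1 d"
  using expansion_value_nonneg[of q0 q1 d] by (simp add: nvalue_def)

lemma nvalue_le_1: "1 < q0 \<Longrightarrow> 1 < q1 \<Longrightarrow> nvalue q0 q1 d \<le> 1"
  using expansion_value_le[of q0 q1 d] by (simp add: nvalue_def field_simps)

text \<open>
  The form of the contraction principle for recursions that peel off one digit, and hence divide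
  by \<open>q0\<close> or \<open>q1\<close>.
\<close>

lemma nvalue_contraction:
  fixes X :: "'s \<Rightarrow> real"
  assumes q: "1 < q0" "1 < q1" and "0 \<le> \<delta>"
    and bdd: "\<And>s. X s \<le> K"
    and step: "\<And>s. \<exists>t. \<exists>b\<in>{q0,q1}. X s \<le> X t / b + \<delta>"
  shows "X s \<le> \<delta> / (1 - 1 / min q0 q1)"
proof (rule contraction_bound[where X = X, OF _ _ _ bdd])
  fix s
  obtain t b where tb: "b \<in> {q0,q1}" "X s \<le> X t / b + \<delta>" using step by blast
  have "X t / b \<le> max 0 (X t) / b" using tb q by (intro divide_right_mono) auto
  also have "\<dots> \<le> max 0 (X t) / min q0 q1" using tb q by (intro divide_left_mono) auto
  finally show "\<exists>t. X s \<le> 1 / min q0 q1 * max 0 (X t) + \<delta>"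
    using tb by (intro exI[of _ t]) simp
qed (use assms in auto)


text \<open>
  The maps \<open>x / q0\<close> and \<open>1 - (1 - x) / q1\<close> are conjugate under \<open>x \<mapsto> 1 - x\<close> to the maps of the opposite
  digits for the exchanged bases.
\<close>

lemma nvalue_flip:
  assumes q: "1 < q0" "1 < q1"
  shows "nvalue q0 q1 (flip d) = 1 - nvalue q1 q0 d"
proof -
  define X where "X d = \<bar>nvalue q0 q1 (flip d) - (1 - nvalue q1 q0 d)\<bar>" for d
  have "X d \<le> 0 / (1 - 1 / min q0 q1)"
  proof (rule nvalue_contraction[where X = X, OF q])
    show "X d \<le> 2" for d
      using nvalue_nonneg[of q0 q1 "flip d"] nvalue_le_1[of q0 q1 "flip d"]
        nvalue_nonneg[of q1 q0 d] nvalue_le_1[of q1 q0 d] q by (simp add: X_def)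
    show "\<exists>t. \<exists>b\<in>{q0, q1}. X d \<le> X t / b + 0" for d
    proof (intro exI bexI)
      have "X d = \<bar>(nvalue q0 q1 (flip (shift d)) - (1 - nvalue q1 q0 (shift d))) / (if d 0 then q0 else q1)\<bar>"
        using q by (auto simp: X_def nvalue_0 nvalue_1 flip_shift flip_apply field_simps)
      then show "X d \<le> X (shift d) / (if d 0 then q0 else q1) + 0"
        using q by (auto simp: X_def)
    qed auto
  qed auto
  then show ?thesis by (simp add: X_def)
qed

text \<open>
  Prefixing a fixed word is an affine map whose slope is the reciprocal of the product of the bases
  of its digits.
\<close>

lemma nvalue_diff_prefix:
  assumes q: "1 < q0" "1 < q1" and "\<And>i. i < n \<Longrightarrow> c i = e i"
  shows "nvalue q0 q1 c - nvalue q0 q1 e =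
    (nvalue q0 q1 ((shift ^^ n) c) - nvalue q0 q1 ((shift ^^ n) e)) / (\<Prod>i<n. base q0 q1 (c i))"
  using assms(3)
proof (induction n arbitrary: c e)
  case (Suc n)
  have "nvalue q0 q1 c - nvalue q0 q1 e =
      (nvalue q0 q1 (shift c) - nvalue q0 q1 (shift e)) / base q0 q1 (c 0)"
    using q Suc.prems[of 0]
    by (cases "c 0") (auto simp: nvalue_0 nvalue_1 base_def field_simps)
  also have "nvalue q0 q1 (shift c) - nvalue q0 q1 (shift e) =
      (nvalue q0 q1 ((shift ^^ n) (shift c)) - nvalue q0 q1 ((shift ^^ n) (shift e)))
        / (\<Prod>i<n. base q0 q1 (shift c i))"
    using Suc.prems by (intro Suc.IH) (auto simp: shift_apply)
  finally have "nvalue q0 q1 c - nvalue q0 q1 e =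
      (nvalue q0 q1 ((shift ^^ n) (shift c)) - nvalue q0 q1 ((shift ^^ n) (shift e)))
        / (\<Prod>i<n. base q0 q1 (shift c i)) / base q0 q1 (c 0)" .
  moreover have "(\<Prod>i<Suc n. base q0 q1 (c i)) = base q0 q1 (c 0) * (\<Prod>i<n. base q0 q1 (shift c i))"
    by (simp add: prod.lessThan_Suc_shift shift_apply del: prod.lessThan_Suc)
  ultimately show ?case
    by (simp only: funpow.simps o_apply funpow_swap1 divide_divide_eq_left mult.commute)
qed simp

lemma nvalue_close:
  assumes q: "1 < q0" "1 < q1" and "\<And>i. i < n \<Longrightarrow> c i = e i"
  shows "\<bar>nvalue q0 q1 c - nvalue q0 q1 e\<bar> \<le> (1 / min q0 q1) ^ n"
proof -
  let ?P = "\<Prod>i<n. base q0 q1 (c i)"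
  have "min q0 q1 ^ n > 0" using q by simp
  have diff: "nvalue q0 q1 c - nvalue q0 q1 e =
      (nvalue q0 q1 ((shift ^^ n) c) - nvalue q0 q1 ((shift ^^ n) e)) / ?P"
    by (intro nvalue_diff_prefix assms)
  have "\<bar>nvalue q0 q1 ((shift ^^ n) c) - nvalue q0 q1 ((shift ^^ n) e)\<bar> \<le> 1"
    using nvalue_nonneg[OF q, of "(shift ^^ n) c"] nvalue_nonneg[OF q, of "(shift ^^ n) e"]
      nvalue_le_1[OF q, of "(shift ^^ n) c"] nvalue_le_1[OF q, of "(shift ^^ n) e"] by linarith
  then have "\<bar>nvalue q0 q1 c - nvalue q0 q1 e\<bar> \<le> 1 / ?P"
    unfolding diff abs_divide
    using prod_base_pos[OF q, of c "{..<n}"] by (simp add: divide_right_mono)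
  also have "\<dots> \<le> 1 / min q0 q1 ^ n"
    using prod_base_ge[OF q, of n c] \<open>min q0 q1 ^ n > 0\<close> by (intro divide_left_mono) auto
  finally show ?thesis by (simp add: power_one_over)
qed

text \<open>
  Joint continuity in the bases: one step of the recursion contributes at most the change of the
  reciprocals, and these errors sum to a geometric series.
\<close>

lemma nvalue_lipschitz:
  assumes q: "1 < q0" "1 < q1" "1 < q0'" "1 < q1'"
  shows "\<bar>nvalue q0 q1 d - nvalue q0' q1' d\<bar>
    \<le> (\<bar>1 / q0 - 1 / q0'\<bar> + \<bar>1 / q1 - 1 / q1'\<bar>) / (1 - 1 / min q0 q1)"
proof -
  let ?X = "\<lambda>d. \<bar>nvalue q0 q1 d - nvalue q0' q1' d\<bar>"
  let ?\<delta> = "\<bar>1 / q0 - 1 / q0'\<bar> + \<bar>1 / q1 - 1 / q1'\<bar>"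
  show ?thesis
  proof (rule nvalue_contraction[where X = ?X, OF q(1,2)])
    show "?X d \<le> 1" for d
      using nvalue_nonneg[OF q(1,2), of d] nvalue_le_1[OF q(1,2), of d]
        nvalue_nonneg[OF q(3,4), of d] nvalue_le_1[OF q(3,4), of d] by simp
    show "\<exists>t. \<exists>b\<in>{q0, q1}. ?X d \<le> ?X t / b + ?\<delta>" for d
    proof (intro exI bexI)
      define h where "h = nvalue q0 q1 (shift d)"
      define h' where "h' = nvalue q0' q1' (shift d)"
      have h': "\<bar>h'\<bar> \<le> 1" "\<bar>1 - h'\<bar> \<le> 1"
        using nvalue_nonneg[OF q(3,4), of "shift d"] nvalue_le_1[OF q(3,4), of "shift d"]
        by (auto simp: h'_def)
      show "?X d \<le> ?X (shift d) / (if d 0 then q1 else q0) + ?\<delta>"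
      proof (cases "d 0")
        case True
        have "?X d = \<bar>(h - h') / q1 - (1 / q1 - 1 / q1') * (1 - h')\<bar>"
          using True q by (simp add: nvalue_1 h_def h'_def field_simps)
        also have "\<dots> \<le> \<bar>(h - h') / q1\<bar> + \<bar>1 / q1 - 1 / q1'\<bar> * \<bar>1 - h'\<bar>"
          unfolding abs_mult[symmetric] by (rule abs_triangle_ineq4)
        also have "\<dots> \<le> \<bar>(h - h') / q1\<bar> + \<bar>1 / q1 - 1 / q1'\<bar> * 1"
          using h' by (intro add_left_mono mult_left_mono) auto
        finally show ?thesis using True q by (simp add: h_def h'_def)
      next
        case False
        have "?X d = \<bar>(h - h') / q0 + (1 / q0 - 1 / q0') * h'\<bar>"
          using False q by (simp add: nvalue_0 h_def h'_def field_simps)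
        also have "\<dots> \<le> \<bar>(h - h') / q0\<bar> + \<bar>1 / q0 - 1 / q0'\<bar> * \<bar>h'\<bar>"
          unfolding abs_mult[symmetric] by (rule abs_triangle_ineq)
        also have "\<dots> \<le> \<bar>(h - h') / q0\<bar> + \<bar>1 / q0 - 1 / q0'\<bar> * 1"
          using h' by (intro add_left_mono mult_left_mono) auto
        finally show ?thesis using False q by (simp add: h_def h'_def)
      qed
    qed auto
  qed auto
qed

text \<open>
  Both maps \<open>x / q0\<close> and \<open>1 - (1 - x) / q1\<close> move points of \<open>[0, 1]\<close> upwards when \<open>q0\<close> decreases and \<open>q1\<close>
  increases.
\<close>

lemma nvalue_mono:
  assumes q: "1 < q0'" "q0' \<le> q0" "1 < q1" "q1 \<le> q1'"
  shows "nvalue q0 q1 d \<le> nvalue q0' q1' d"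
proof -
  let ?X = "\<lambda>d. nvalue q0 q1 d - nvalue q0' q1' d"
  have q': "1 < q0" "1 < q1'" using q by auto
  have "?X d \<le> 0 / (1 - 1 / min q0 q1)"
  proof (rule nvalue_contraction[where X = ?X, OF q'(1) q(3)])
    show "?X d \<le> 1" for d
      using nvalue_le_1[OF q'(1) q(3), of d] nvalue_nonneg[OF q(1) q'(2), of d] by simp
    show "\<exists>t. \<exists>b\<in>{q0, q1}. ?X d \<le> ?X t / b + 0" for d
    proof (intro exI bexI)
      define h' where "h' = nvalue q0' q1' (shift d)"
      have h': "0 \<le> h'" "h' \<le> 1"
        using nvalue_nonneg[OF q(1) q'(2)] nvalue_le_1[OF q(1) q'(2)] by (auto simp: h'_def)
      have "h' / q0 \<le> h' / q0'" "(1 - h') / q1' \<le> (1 - h') / q1"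
        using q q' h' by (auto intro!: divide_left_mono)
      then show "?X d \<le> ?X (shift d) / (if d 0 then q1 else q0) + 0"
        using q q' by (auto simp: nvalue_0 nvalue_1 h'_def diff_divide_distrib)
    qed auto
  qed auto
  then show ?thesis by simp
qed

text \<open>
  The value is smallest when the digit 1 at position \<open>k\<close> is the only one.
\<close>

lemma nvalue_lower_bound:
  assumes q: "1 < q0" "1 < q1" and "d k"
  shows "(1 / q0) ^ k * (1 - 1 / q1) \<le> nvalue q0 q1 d"
  using \<open>d k\<close>
proof (induction k arbitrary: d)
  case 0
  then show ?case
    using q nvalue_nonneg[OF q, of "shift d"] by (simp add: nvalue_1 diff_divide_distrib)
next
  case (Suc k)
  have q1: "0 \<le> 1 - 1 / q1" using q by simp
  show ?case
  proof (cases "d 0")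
    case True
    have "(1 / q0) ^ Suc k * (1 - 1 / q1) \<le> 1 * (1 - 1 / q1)"
      using q q1 by (intro mult_right_mono power_le_one) auto
    then show ?thesis
      using True q divide_nonneg_pos[OF nvalue_nonneg[OF q, of "shift d"], of q1]
      by (simp add: nvalue_1 diff_divide_distrib)
  next
    case False
    have "(1 / q0) ^ k * (1 - 1 / q1) \<le> nvalue q0 q1 (shift d)"
      using Suc.prems by (intro Suc.IH) (simp add: shift_apply)
    then have "(1 / q0) ^ k * (1 - 1 / q1) / q0 \<le> nvalue q0 q1 (shift d) / q0"
      using q by (intro divide_right_mono) auto
    then show ?thesis
      using False q by (simp add: nvalue_0)
  qed
qed

lemma nvalue_pos:
  assumes q: "1 < q0" "1 < q1" and "d k"
  shows "0 < nvalue q0 q1 d"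
proof -
  have "0 < (1 / q0) ^ k * (1 - 1 / q1)" using q by simp
  with nvalue_lower_bound[where d = d, OF assms] show ?thesis by simp
qed

lemma nvalue_less_1:
  assumes q: "1 < q0" "1 < q1" and "\<not> d k"
  shows "nvalue q0 q1 d < 1"
  using nvalue_pos[of q1 q0 "flip d" k] nvalue_flip[of q1 q0 d] assms by (simp add: flip_apply)

text \<open>
  Changing \<open>q0\<close> is felt at a digit 0 unless the rest of the sequence has value 0, which is excluded by a
  later digit 1. The strict inequality then survives prefixing.
\<close>

lemma nvalue_strict_mono_q0:
  assumes q: "1 < q0'" "q0' < q0" "1 < q1" "q1 \<le> q1'" and d: "\<not> d n" "d k" "n < k"
  shows "nvalue q0 q1 d < nvalue q0' q1' d"
  using d
proof (induction n arbitrary: d k)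
  case 0
  then obtain k' where k': "k = Suc k'" by (cases k) auto
  have "nvalue q0 q1 d = nvalue q0 q1 (shift d) / q0"
    using 0 q by (simp add: nvalue_0)
  also have "\<dots> < nvalue q0 q1 (shift d) / q0'"
    using q 0 k' nvalue_pos[of q0 q1 "shift d" k'] by (intro divide_strict_left_mono) (auto simp: shift_apply)
  also have "\<dots> \<le> nvalue q0' q1' (shift d) / q0'"
    using q by (intro divide_right_mono nvalue_mono) auto
  also have "\<dots> = nvalue q0' q1' d"
    using 0 q by (simp add: nvalue_0)
  finally show ?case .
next
  case (Suc n)
  have IH: "nvalue q0 q1 (shift d) < nvalue q0' q1' (shift d)"
    using Suc.prems by (intro Suc.IH[of _ "k - 1"]) (auto simp: shift_apply)
  show ?case
  proof (cases "d 0")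
    case True
    have "(1 - nvalue q0' q1' (shift d)) / q1' \<le> (1 - nvalue q0' q1' (shift d)) / q1"
      using q nvalue_le_1[of q0' q1' "shift d"] by (intro divide_left_mono) auto
    also have "\<dots> < (1 - nvalue q0 q1 (shift d)) / q1"
      using q IH by (intro divide_strict_right_mono) auto
    finally show ?thesis using True q by (simp add: nvalue_1)
  next
    case False
    have "nvalue q0 q1 (shift d) / q0 < nvalue q0' q1' (shift d) / q0"
      using q IH by (intro divide_strict_right_mono) auto
    also have "\<dots> \<le> nvalue q0' q1' (shift d) / q0'"
      using q nvalue_nonneg[of q0' q1' "shift d"] by (intro divide_left_mono) auto
    finally show ?thesis using False q by (simp add: nvalue_0)
  qed
qed

lemma nvalue_strict_mono_q1:
  assumes q: "1 < q0'" "q0' \<le> q0" "1 < q1" "q1 < q1'" and d: "d n" "\<not> d k" "n < k"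
  shows "nvalue q0 q1 d < nvalue q0' q1' d"
  using nvalue_strict_mono_q0[of q1 q1' q0' q0 "flip d" n k]
    nvalue_flip[of q1 q0 d] nvalue_flip[of q1' q0' d] assms by (simp add: flip_apply)


section \<open>Quasi-greedy expansions\<close>

text \<open>
  The conditions that membership in \<open>B'\<close> imposes on the second component; the first component
  satisfies them after exchanging the digits (\<open>B'_iff\<close>).
\<close>

definition self_maximal :: "binseq \<Rightarrow> bool" where
  "self_maximal d \<longleftrightarrow> d 0 \<and> \<not> finite_seq d \<and> d \<noteq> const_seq True \<and> (\<forall>n. (shift ^^ n) d \<preceq>\<^sub>l d)"

text \<open>
  A digit 1 is possible for the value \<open>x\<close> iff \<open>x \<ge> 1 - 1 / q1\<close>. The quasi-greedy algorithm chooses it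
  only if the inequality is strict, so that a positive value remains for the following digits.
\<close>

definition greedy_digits :: "real \<Rightarrow> real \<Rightarrow> binseq \<Rightarrow> bool" where
  "greedy_digits q0 q1 d \<longleftrightarrow> (\<forall>n. d n \<longleftrightarrow> 1 - 1 / q1 < nvalue q0 q1 ((shift ^^ n) d))"

lemma lex_le_refl [simp]: "d \<preceq>\<^sub>l d"
  by (simp add: lex_le_def)

lemma lex_le_antisym: "c \<preceq>\<^sub>l e \<Longrightarrow> e \<preceq>\<^sub>l c \<Longrightarrow> c = e"
  using less_fun_asym by (auto simp: lex_le_def)

lemma lex_less_cases:
  assumes "c \<preceq>\<^sub>l e" "c \<noteq> e"
  obtains n where "\<forall>i<n. c i = e i" "\<not> c n" "e n"
  using assms unfolding lex_le_def by (auto elim!: less_funE)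

lemma not_lex_le_cases:
  assumes "\<not> c \<preceq>\<^sub>l e"
  obtains n where "\<forall>i<n. c i = e i" "c n" "\<not> e n"
proof -
  have ne: "c \<noteq> e" using assms by auto
  define n where "n = (LEAST i. c i \<noteq> e i)"
  have n: "c n \<noteq> e n"
    unfolding n_def by (rule LeastI_ex) (use ne in auto)
  have lt: "c i = e i" if "i < n" for i
    using that not_less_Least unfolding n_def by blast
  have "\<not> (\<not> c n \<and> e n)"
    using assms lt unfolding lex_le_def less_fun_def by (auto simp: less_bool_def)
  then show ?thesis using that n lt by blast
qed

text \<open>
  The sequence \<open>0\<^sup>\<infinity>\<close> counts as infinite, hence one digit 1 has to be supplied.
\<close>

lemma infinite_seq_later_one:
  assumes "\<not> finite_seq d" "d n"
  obtains k where "n < k" "d k"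
  using assms unfolding finite_seq_def by blast

lemma infinite_seq_ones:
  assumes "\<not> finite_seq d" "d k0"
  shows "\<exists>k\<ge>n. d k"
proof (induction n)
  case 0
  then show ?case using assms by blast
next
  case (Suc n)
  then obtain k where k: "k \<ge> n" "d k" by blast
  obtain k' where "k < k'" "d k'" using infinite_seq_later_one[OF assms(1) k(2)] .
  then show ?case using k by (intro exI[of _ k']) auto
qed

lemma infinite_seq_funpow_shift:
  assumes "\<not> finite_seq d" shows "\<not> finite_seq ((shift ^^ n) d)"
proof
  assume "finite_seq ((shift ^^ n) d)"
  then obtain K where K: "d (K + n)" "\<And>k. k > K \<Longrightarrow> \<not> d (k + n)"
    by (auto simp: finite_seq_def funpow_shift)
  obtain k where "K + n < k" "d k" using infinite_seq_later_one[OF assms K(1)] .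
  then show False using K(2)[of "k - n"] by (simp add: less_diff_conv)
qed

lemma nvalue_tail_0:
  assumes "1 < q0" "1 < q1" "\<not> d n"
  shows "nvalue q0 q1 ((shift ^^ n) d) = nvalue q0 q1 ((shift ^^ Suc n) d) / q0"
  using nvalue_0[of q0 q1 "(shift ^^ n) d"] assms by (simp add: funpow_shift)

lemma nvalue_tail_1:
  assumes "1 < q0" "1 < q1" "d n"
  shows "nvalue q0 q1 ((shift ^^ n) d) = 1 - (1 - nvalue q0 q1 ((shift ^^ Suc n) d)) / q1"
  using nvalue_1[of q0 q1 "(shift ^^ n) d"] assms by (simp add: funpow_shift)

text \<open>
  At the first difference the larger sequence has a digit 1, hence, being infinite, a tail of value
  greater than \<open>1 - 1 / q1\<close>, while the greedy sequence has digit 0 there and a tail of value at most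
  \<open>1 - 1 / q1\<close>. The common prefix preserves the order of the tail values. This gives both the
  maximality of greedy digits among infinite expansions and their monotonicity in the value.
\<close>

lemma greedy_digits_maximal:
  assumes q: "1 < q0" "1 < q1" and d: "greedy_digits q0 q1 d"
    and e: "\<not> finite_seq e" "nvalue q0 q1 e \<le> nvalue q0 q1 d"
  shows "e \<preceq>\<^sub>l d"
proof (rule ccontr)
  assume "\<not> e \<preceq>\<^sub>l d"
  then obtain n where n: "\<forall>i<n. e i = d i" "e n" "\<not> d n"
    by (rule not_lex_le_cases)
  let ?P = "\<Prod>i<n. base q0 q1 (e i)"
  obtain k where k: "n < k" "e k" using infinite_seq_later_one[OF e(1) n(2)] .
  have "0 < nvalue q0 q1 ((shift ^^ Suc n) e)"
    using k by (intro nvalue_pos[where k = "k - Suc n"] q) (simp add: funpow_shift del: funpow.simps)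
  then have "1 - 1 / q1 < nvalue q0 q1 ((shift ^^ n) e)"
    using q divide_strict_right_mono[of 0 "nvalue q0 q1 ((shift ^^ Suc n) e)" q1]
    unfolding nvalue_tail_1[where d = e and n = n, OF q n(2)] diff_divide_distrib by linarith
  moreover have "nvalue q0 q1 ((shift ^^ n) d) \<le> 1 - 1 / q1"
    using d n(3) unfolding greedy_digits_def by (metis not_less)
  ultimately have "0 < (nvalue q0 q1 ((shift ^^ n) e) - nvalue q0 q1 ((shift ^^ n) d)) / ?P"
    using prod_base_pos[OF q, of e "{..<n}"] by (intro divide_pos_pos) auto
  also have "\<dots> = nvalue q0 q1 e - nvalue q0 q1 d"
    using nvalue_diff_prefix[of q0 q1 n e d] q n(1) by simp
  finally show False using e(2) by simp
qed

text \<open>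
  Iterate the inverse maps, choosing the digit by the greedy rule. The assumption on the bases keeps
  the orbit in the half-open interval from 0 to 1; as the orbit stays positive, the digits cannot
  end in zeros.
\<close>

lemma greedy_digits_exist:
  assumes q: "1 < q0" "1 < q1" "q0 * (1 - 1 / q1) \<le> 1" and x: "0 < x" "x \<le> 1"
  obtains d where "greedy_digits q0 q1 d" "\<not> finite_seq d" "nvalue q0 q1 d = x"
proof -
  \<comment> \<open>the orbit of \<open>x\<close> under the inverse maps\<close>
  define X where "X = rec_nat x (\<lambda>_ y. if 1 - 1 / q1 < y then 1 - q1 * (1 - y) else q0 * y)"
  define d where "d n \<longleftrightarrow> 1 - 1 / q1 < X n" for n
  have X_Suc: "X (Suc n) = (if d n then 1 - q1 * (1 - X n) else q0 * X n)" for n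
    by (simp add: X_def d_def)
  have X_bounds: "0 < X n \<and> X n \<le> 1" for n
  proof (induction n)
    case 0
    show ?case using x by (simp add: X_def)
  next
    case (Suc n)
    show ?case
    proof (cases "d n")
      case True
      then have "1 - X n < 1 / q1" by (simp add: d_def)
      then have "q1 * (1 - X n) < 1" using q by (simp add: field_simps)
      moreover have "0 \<le> q1 * (1 - X n)" using q Suc by simp
      ultimately show ?thesis using True by (simp add: X_Suc)
    next
      case False
      then have "q0 * X n \<le> q0 * (1 - 1 / q1)" using q by (simp add: d_def)
      with q(3) have "q0 * X n \<le> 1" by linarith
      moreover have "0 < q0 * X n" using q Suc by simp
      ultimately show ?thesis using False by (simp add: X_Suc)
    qed
  qed
  have orbit: "nvalue q0 q1 ((shift ^^ n) d) = X n" for n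
  proof -
    define D where "D n = \<bar>nvalue q0 q1 ((shift ^^ n) d) - X n\<bar>" for n
    have "D n \<le> 0 / (1 - 1 / min q0 q1)"
    proof (rule nvalue_contraction[where X = D, OF q(1,2)])
      show "D n \<le> 1" for n
        using nvalue_nonneg[OF q(1,2), of "(shift ^^ n) d"] nvalue_le_1[OF q(1,2), of "(shift ^^ n) d"]
          X_bounds[of n] by (auto simp: D_def)
      show "\<exists>t. \<exists>b\<in>{q0, q1}. D n \<le> D t / b + 0" for n
      proof (intro exI bexI)
        have "nvalue q0 q1 ((shift ^^ n) d) - X n =
            (nvalue q0 q1 ((shift ^^ Suc n) d) - X (Suc n)) / (if d n then q1 else q0)"
          using q nvalue_tail_0[of q0 q1 d n] nvalue_tail_1[of q0 q1 d n]
          by (auto simp: X_Suc field_simps simp del: funpow.simps)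
        then have "D n = D (Suc n) / (if d n then q1 else q0)"
          unfolding D_def using q by (simp only: abs_divide) auto
        then show "D n \<le> D (Suc n) / (if d n then q1 else q0) + 0" by simp
      qed auto
    qed auto
    then show ?thesis by (simp add: D_def)
  qed
  have "greedy_digits q0 q1 d"
    unfolding greedy_digits_def orbit by (simp add: d_def)
  moreover have "\<not> finite_seq d"
  proof
    assume "finite_seq d"
    then obtain K where K: "\<And>k. k > K \<Longrightarrow> \<not> d k" by (auto simp: finite_seq_def)
    have "(shift ^^ Suc K) d = (\<lambda>i. False)"
      using K by (intro ext) (simp add: funpow_shift del: funpow.simps)
    then have "X (Suc K) = nvalue q0 q1 (\<lambda>i. False)"
      using orbit[of "Suc K"] by simp
    also have "\<dots> = 0" by (simp add: nvalue_def expansion_value_def)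
    finally show False using X_bounds[of "Suc K"] by simp
  qed
  moreover have "nvalue q0 q1 d = x"
    using orbit[of 0] by (simp add: X_def)
  ultimately show ?thesis using that by blast
qed

text \<open>
  The normalized value of \<open>rr\<close> is \<open>q0 * (1 - 1 / q1)\<close>, the image of the threshold \<open>1 - 1 / q1\<close> under
  the inverse map of digit 0, and is thus the largest point that a digit 0 can produce. The inverse
  map of digit 1 does not lead beyond it either, as \<open>q0 * q1 \<le> q0 + q1\<close>. So the tails of the greedy
  expansion of \<open>rr\<close> have values at most that of the whole sequence.
\<close>

lemma greedy_orbit_bound:
  assumes q: "1 < q0" "1 < q1" "q1 * (1 - 1 / q0) \<le> 1" and d: "greedy_digits q0 q1 d"
    and d0: "nvalue q0 q1 d \<le> q0 * (1 - 1 / q1)"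
  shows "nvalue q0 q1 ((shift ^^ n) d) \<le> q0 * (1 - 1 / q1)"
proof (induction n)
  case (Suc n)
  show ?case
  proof (cases "d n")
    case True
    have "1 - q1 * (1 - nvalue q0 q1 ((shift ^^ n) d)) \<le> 1 - q1 * (1 - q0 * (1 - 1 / q1))"
      using q Suc by simp
    also have "\<dots> = 1 - q1 + q0 * (q1 - 1)"
      using q by (simp add: field_simps)
    also have "\<dots> = (q0 - 1) * (q1 - 1)"
      by (simp add: algebra_simps)
    also have "\<dots> \<le> q0 * (1 - 1 / q1)"
    proof -
      have "q1 * (q0 - 1) \<le> q0" using q by (simp add: field_simps)
      then have "q1 * (q0 - 1) * (q1 - 1) \<le> q0 * (q1 - 1)" using q by (intro mult_right_mono) auto
      then show ?thesis using q by (simp add: field_simps)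
    qed
    finally show ?thesis
      using nvalue_tail_1[of q0 q1 d n] True q by (simp add: field_simps del: funpow.simps)
  next
    case False
    have "nvalue q0 q1 ((shift ^^ n) d) \<le> 1 - 1 / q1"
      using d False unfolding greedy_digits_def by (metis not_less)
    then have "q0 * nvalue q0 q1 ((shift ^^ n) d) \<le> q0 * (1 - 1 / q1)"
      using q by simp
    then show ?thesis
      using nvalue_tail_0[of q0 q1 d n] False q by (simp del: funpow.simps)
  qed
qed (use d0 in simp)

text \<open>
  Parry's argument. If the \<open>n\<close>-th shift differs from \<open>d\<close> first at position \<open>k\<close>, it has digit 0 there
  where \<open>d\<close> has 1, so its excess over the value of \<open>d\<close> is at most \<open>1 / q0\<close> times the excess of a later
  shift. A bounded quantity that is dominated in this way cannot be positive.
\<close>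

lemma self_maximal_value_bound:
  assumes q: "1 < q0" "1 < q1" and d: "d 0" "\<not> finite_seq d" "\<And>n. (shift ^^ n) d \<preceq>\<^sub>l d"
    and val: "nvalue q0 q1 d = q0 * (1 - 1 / q1)"
  shows "nvalue q0 q1 ((shift ^^ n) d) \<le> nvalue q0 q1 d"
proof -
  define e where "e n = nvalue q0 q1 ((shift ^^ n) d) - nvalue q0 q1 d" for n
  have "e n \<le> 0 / (1 - 1 / q0)"
  proof (rule contraction_bound[where X = e])
    show "e n \<le> 1" for n
      using nvalue_nonneg[OF q, of d] nvalue_le_1[OF q, of "(shift ^^ n) d"] by (simp add: e_def)
    show "\<exists>t. e n \<le> 1 / q0 * max 0 (e t) + 0" for n
    proof (cases "(shift ^^ n) d = d")
      case True
      then show ?thesis using q by (intro exI[of _ n]) (simp add: e_def)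
    next
      case False
      then obtain k where k: "\<forall>i<k. (shift ^^ n) d i = d i" "\<not> (shift ^^ n) d k" "d k"
        using d(3)[of n] by (auto elim: lex_less_cases)
      let ?P = "\<Prod>i<k. base q0 q1 ((shift ^^ n) d i)"
      have P: "1 \<le> ?P"
        using q by (intro prod_ge_1) (auto simp: base_def)
      obtain j where j: "k < j" "d j" using infinite_seq_later_one[OF d(2) k(3)] .
      have "0 < nvalue q0 q1 ((shift ^^ Suc k) d)"
        using j by (intro nvalue_pos[where k = "j - Suc k"] q) (simp add: funpow_shift del: funpow.simps)
      \<comment> \<open>the tail of \<open>d\<close> from \<open>k\<close> on has at least the threshold value, and this is \<open>1 / q0\<close> times the value of \<open>d\<close>\<close>
      then have 1: "1 - 1 / q1 \<le> nvalue q0 q1 ((shift ^^ k) d)"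
        using q divide_strict_right_mono[of 0 "nvalue q0 q1 ((shift ^^ Suc k) d)" q1]
        unfolding nvalue_tail_1[where d = d and n = k, OF q k(3)] diff_divide_distrib by linarith
      have comp: "(shift ^^ k) ((shift ^^ n) d) = (shift ^^ (k + n)) d"
        by (simp add: funpow_add)
      have "\<not> d (k + n)" using k(2) by (simp add: funpow_shift)
      then have 2: "nvalue q0 q1 ((shift ^^ k) ((shift ^^ n) d)) = nvalue q0 q1 ((shift ^^ Suc (k + n)) d) / q0"
        unfolding comp by (intro nvalue_tail_0 q)
      have "e n = (nvalue q0 q1 ((shift ^^ k) ((shift ^^ n) d)) - nvalue q0 q1 ((shift ^^ k) d)) / ?P"
        unfolding e_def using k(1) by (intro nvalue_diff_prefix q) simp
      also have "\<dots> \<le> (e (Suc (k + n)) / q0) / ?P"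
      proof (rule divide_right_mono)
        have "q0 * (1 - 1 / q1) / q0 = 1 - 1 / q1" using q by simp
        then show "nvalue q0 q1 ((shift ^^ k) ((shift ^^ n) d)) - nvalue q0 q1 ((shift ^^ k) d)
            \<le> e (Suc (k + n)) / q0"
          using 1 unfolding 2 e_def val diff_divide_distrib by linarith
      qed (use P in simp)
      also have "\<dots> \<le> (max 0 (e (Suc (k + n))) / q0) / ?P"
        using q P by (intro divide_right_mono) auto
      also have "\<dots> \<le> (max 0 (e (Suc (k + n))) / q0) / 1"
        using q P by (intro divide_left_mono) auto
      finally show ?thesis by (intro exI[of _ "Suc (k + n)"]) simp
    qed
  qed (use q in auto)
  then show ?thesis by (simp add: e_def)
qed

text \<open>
  After a digit 1 the remaining value is positive, which gives the strict inequality of the greedy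
  rule; after a digit 0 it is at most \<open>q0 * (1 - 1 / q1)\<close>, which is the other half of the rule.
\<close>

lemma self_maximal_greedy_digits:
  assumes q: "1 < q0" "1 < q1" and d: "d 0" "\<not> finite_seq d" "\<And>n. (shift ^^ n) d \<preceq>\<^sub>l d"
    and val: "nvalue q0 q1 d = q0 * (1 - 1 / q1)"
  shows "greedy_digits q0 q1 d"
  unfolding greedy_digits_def
proof
  fix n
  obtain j where j: "j \<ge> Suc n" "d j" using infinite_seq_ones[OF d(2,1)] by blast
  have pos: "0 < nvalue q0 q1 ((shift ^^ Suc n) d)"
    using j by (intro nvalue_pos[where k = "j - Suc n"] q) (simp add: funpow_shift del: funpow.simps)
  show "d n \<longleftrightarrow> 1 - 1 / q1 < nvalue q0 q1 ((shift ^^ n) d)"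
  proof (cases "d n")
    case True
    have "1 - 1 / q1 < nvalue q0 q1 ((shift ^^ n) d)"
      using q divide_strict_right_mono[OF pos, of q1]
      unfolding nvalue_tail_1[where d = d and n = n, OF q True] diff_divide_distrib by linarith
    then show ?thesis using True by simp
  next
    case False
    have "nvalue q0 q1 ((shift ^^ Suc n) d) \<le> q0 * (1 - 1 / q1)"
      using self_maximal_value_bound[OF q d val, of "Suc n"] val by simp
    then have "nvalue q0 q1 ((shift ^^ Suc n) d) / q0 \<le> q0 * (1 - 1 / q1) / q0"
      using q by (intro divide_right_mono) auto
    then have "nvalue q0 q1 ((shift ^^ n) d) \<le> 1 - 1 / q1"
      unfolding nvalue_tail_0[where d = d and n = n, OF q False] using q by simp
    then show ?thesis using False by simp
  qed
qed


section \<open>Pairs of bases and their codes\<close>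

lemma is_expansion_iff:
  assumes "1 < q1"
  shows "is_expansion q0 q1 x d \<longleftrightarrow> nvalue q0 q1 d = (q1 - 1) * x"
  using assms by (auto simp: is_expansion_def nvalue_def)

lemma nvalue_const_False: "nvalue q0 q1 (const_seq False) = 0"
  by (simp add: nvalue_def expansion_value_def const_seq_def)

lemma nvalue_const_True:
  assumes "1 < q0" "1 < q1" shows "nvalue q0 q1 (const_seq True) = 1"
proof -
  have "const_seq True = flip (const_seq False)" by (simp add: const_seq_def flip_def)
  then show ?thesis using nvalue_flip[OF assms] nvalue_const_False by simp
qed

lemma B_bounds:
  assumes "(q0, q1) \<in> B"
  shows "1 < q0" "1 < q1" "q0 * (1 - 1 / q1) < 1" "q1 * (1 - 1 / q0) < 1" "(q0 - 1) * (q1 - 1) < 1"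
  using assms by (auto simp: B_def field_simps)

lemma quasi_greedy_unique:
  assumes "is_quasi_greedy q0 q1 x d" "is_quasi_greedy q0 q1 x e" shows "d = e"
  using assms lex_le_antisym unfolding is_quasi_greedy_def by blast

lemma greedy_digits_quasi_greedy:
  assumes q: "1 < q0" "1 < q1" and d: "greedy_digits q0 q1 d" "\<not> finite_seq d" "is_expansion q0 q1 x d"
  shows "is_quasi_greedy q0 q1 x d"
  using greedy_digits_maximal[OF q d(1)] d q unfolding is_quasi_greedy_def
  by (auto simp: is_expansion_iff)

text \<open>
  Removing the leading 1 turns the equation for \<open>rr\<close> into one whose right-hand side is symmetric in the
  two bases.
\<close>

lemma nvalue_shift_iff:
  assumes "1 < q0" "1 < q1" "d 0"
  shows "nvalue q0 q1 d = (q1 - 1) * rr q0 q1 \<longleftrightarrow> nvalue q0 q1 (shift d) = (q0 - 1) * (q1 - 1)"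
  using assms by (simp add: nvalue_1 rr_def field_simps)

lemma rr_normalized: "0 < q1 \<Longrightarrow> (q1 - 1) * rr q0 q1 = q0 * (1 - 1 / q1)"
  by (simp add: rr_def field_simps)

lemma quasi_greedy_rr_exists:
  assumes B: "(q0, q1) \<in> B"
  obtains d where "is_quasi_greedy q0 q1 (rr q0 q1) d" "self_maximal d"
proof -
  note q = B_bounds[OF B]
  obtain d where d: "greedy_digits q0 q1 d" "\<not> finite_seq d" "nvalue q0 q1 d = q0 * (1 - 1 / q1)"
    using greedy_digits_exist[of q0 q1 "q0 * (1 - 1 / q1)"] q by auto
  have "is_quasi_greedy q0 q1 (rr q0 q1) d"
    using q d by (intro greedy_digits_quasi_greedy) (auto simp: is_expansion_iff rr_normalized)
  moreover have "self_maximal d"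
    unfolding self_maximal_def
  proof (intro conjI allI)
    have "1 * (1 - 1 / q1) < q0 * (1 - 1 / q1)"
      using q by (intro mult_strict_right_mono) auto
    then show "d 0" using d(1) unfolding greedy_digits_def by (auto simp: d(3) dest!: spec[of _ 0])
    show "\<not> finite_seq d" by fact
    show "d \<noteq> const_seq True" using nvalue_const_True[OF q(1,2)] d(3) q by auto
    show "(shift ^^ n) d \<preceq>\<^sub>l d" for n
      using greedy_orbit_bound[of q0 q1 d n] d q
      by (intro greedy_digits_maximal infinite_seq_funpow_shift) auto
  qed
  ultimately show ?thesis using that by blast
qed

text \<open>
  One direction is the uniqueness of quasi-greedy expansions, by which \<open>d\<close> is the sequence of greedy
  digits; the other one is Parry's argument, by which \<open>d\<close> follows the greedy rule.
\<close>

lemma quasi_greedy_rr_iff: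
  assumes B: "(q0, q1) \<in> B"
  shows "is_quasi_greedy q0 q1 (rr q0 q1) d \<longleftrightarrow>
    self_maximal d \<and> nvalue q0 q1 (shift d) = (q0 - 1) * (q1 - 1)"
proof
  note q = B_bounds[OF B]
  assume d: "is_quasi_greedy q0 q1 (rr q0 q1) d"
  obtain g where g: "is_quasi_greedy q0 q1 (rr q0 q1) g" "self_maximal g"
    by (rule quasi_greedy_rr_exists[OF B])
  have "self_maximal d" using quasi_greedy_unique[OF d g(1)] g(2) by simp
  moreover have "nvalue q0 q1 d = (q1 - 1) * rr q0 q1"
    using d q by (simp add: is_quasi_greedy_def is_expansion_iff)
  ultimately show "self_maximal d \<and> nvalue q0 q1 (shift d) = (q0 - 1) * (q1 - 1)"
    using q nvalue_shift_iff[of q0 q1 d] by (auto simp: self_maximal_def)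
next
  note q = B_bounds[OF B]
  assume d: "self_maximal d \<and> nvalue q0 q1 (shift d) = (q0 - 1) * (q1 - 1)"
  then have val: "nvalue q0 q1 d = (q1 - 1) * rr q0 q1"
    using q nvalue_shift_iff[of q0 q1 d] by (auto simp: self_maximal_def)
  have "greedy_digits q0 q1 d"
    using d q val by (intro self_maximal_greedy_digits) (auto simp: self_maximal_def rr_normalized)
  then show "is_quasi_greedy q0 q1 (rr q0 q1) d"
    using d q val by (intro greedy_digits_quasi_greedy) (auto simp: self_maximal_def is_expansion_iff)
qed

lemma lex_le_flip: "flip c \<preceq>\<^sub>l flip e \<longleftrightarrow> e \<preceq>\<^sub>l c"
proof -
  have "flip c = flip e \<longleftrightarrow> c = e" by (metis flip_flip)
  then show ?thesis
    by (auto simp: lex_le_def less_fun_def flip_apply less_bool_def)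
qed

text \<open>
  Exchanging the digits reverses the lexicographic order and interchanges finite with co-finite
  sequences, and in normalized form \<open>ell q0 q1\<close> is 1 minus \<open>rr q1 q0\<close>.
\<close>

lemma quasi_lazy_ell_iff:
  assumes q: "1 < q0" "1 < q1"
  shows "is_quasi_lazy q0 q1 (ell q0 q1) d \<longleftrightarrow> is_quasi_greedy q1 q0 (rr q1 q0) (flip d)"
proof -
  have exp: "is_expansion q0 q1 (ell q0 q1) e \<longleftrightarrow> is_expansion q1 q0 (rr q1 q0) (flip e)" for e
  proof -
    have "(q1 - 1) * ell q0 q1 = 1 - (q0 - 1) * rr q1 q0"
      using q by (simp add: ell_def rr_def field_simps)
    then show ?thesis
      using q by (auto simp: is_expansion_iff nvalue_flip)
  qed
  have all_flip: "(\<forall>e. P (flip e)) \<longleftrightarrow> (\<forall>e. P e)" for P :: "binseq \<Rightarrow> bool"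
    by (metis flip_flip)
  have "is_quasi_lazy q0 q1 (ell q0 q1) d \<longleftrightarrow>
      is_expansion q1 q0 (rr q1 q0) (flip d) \<and> \<not> finite_seq (flip d) \<and>
      (\<forall>e. is_expansion q1 q0 (rr q1 q0) (flip e) \<and> \<not> finite_seq (flip e) \<longrightarrow> flip e \<preceq>\<^sub>l flip d)"
    by (simp add: is_quasi_lazy_def exp cofinite_seq_def flip_def[symmetric] lex_le_flip)
  also have "\<dots> \<longleftrightarrow> is_quasi_greedy q1 q0 (rr q1 q0) (flip d)"
    unfolding is_quasi_greedy_def all_flip[of "\<lambda>e. is_expansion q1 q0 (rr q1 q0) e \<and> \<not> finite_seq e \<longrightarrow> e \<preceq>\<^sub>l flip d"] ..
  finally show ?thesis .
qed

lemma finite_seq_iff_append: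
  "finite_seq d \<longleftrightarrow> (\<exists>w. w \<noteq> [] \<and> last w = True \<and> d = append_seq w (const_seq False))"
proof
  assume "finite_seq d"
  then obtain K where K: "d K" "\<And>k. k > K \<Longrightarrow> \<not> d k" by (auto simp: finite_seq_def)
  show "\<exists>w. w \<noteq> [] \<and> last w = True \<and> d = append_seq w (const_seq False)"
  proof (intro exI conjI)
    show "map d [0..<Suc K] \<noteq> []" by simp
    show "last (map d [0..<Suc K]) = True" using K by simp
    show "d = append_seq (map d [0..<Suc K]) (const_seq False)"
    proof
      fix i
      show "d i = append_seq (map d [0..<Suc K]) (const_seq False) i"
        using K(2)[of i] by (auto simp: append_seq_def const_seq_def simp del: upt_Suc)
    qed
  qed
next
  assume "\<exists>w. w \<noteq> [] \<and> last w = True \<and> d = append_seq w (const_seq False)"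
  then obtain w where w: "w \<noteq> []" "last w" "d = append_seq w (const_seq False)" by auto
  then show "finite_seq d"
    unfolding finite_seq_def
    by (intro exI[of _ "length w - 1"]) (auto simp: append_seq_def const_seq_def last_conv_nth)
qed

lemma cofinite_seq_iff_append:
  "finite_seq (flip d) \<longleftrightarrow> (\<exists>w. w \<noteq> [] \<and> last w = False \<and> d = append_seq w (const_seq True))"
proof -
  have flip_app: "flip (append_seq w (const_seq b)) = append_seq (map Not w) (const_seq (\<not> b))" for w b
    by (auto simp: append_seq_def flip_def const_seq_def fun_eq_iff)
  show ?thesis
    unfolding finite_seq_iff_append
  proof (intro iffI; elim exE conjE)
    fix w
    assume w: "w \<noteq> []" "last w = True" "flip d = append_seq w (const_seq False)"
    then have "d = append_seq (map Not w) (const_seq True)"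
      by (metis flip_app flip_flip not_False_eq_True)
    then show "\<exists>w. w \<noteq> [] \<and> last w = False \<and> d = append_seq w (const_seq True)"
      using w by (intro exI[of _ "map Not w"]) (auto simp: last_map)
  next
    fix w
    assume "w \<noteq> []" "last w = False" "d = append_seq w (const_seq True)"
    then show "\<exists>w. w \<noteq> [] \<and> last w = True \<and> flip d = append_seq w (const_seq False)"
      by (intro exI[of _ "map Not w"]) (auto simp: last_map flip_app)
  qed
qed

lemma B'_iff: "(m, a) \<in> B' \<longleftrightarrow> self_maximal (flip m) \<and> self_maximal a"
proof -
  have "flip m \<noteq> const_seq True \<longleftrightarrow> m \<noteq> const_seq False"
    by (auto simp: flip_def const_seq_def fun_eq_iff)
  then show ?thesis
    unfolding B'_def C'_def self_maximal_def flip_funpow_shift lex_le_flip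
      cofinite_seq_iff_append finite_seq_iff_append[of a]
    by (auto simp: Sigma2_0_def Sigma2_1_def flip_apply)
qed

text \<open>
  The second equation is the first one for the mirrored sequence and exchanged bases.
\<close>

definition solves :: "binseq \<Rightarrow> binseq \<Rightarrow> real \<Rightarrow> real \<Rightarrow> bool" where
  "solves m a q0 q1 \<longleftrightarrow> nvalue q0 q1 (shift a) = (q0 - 1) * (q1 - 1) \<and>
    nvalue q0 q1 (shift m) = 1 - (q0 - 1) * (q1 - 1)"

text \<open>
  This reduces the theorem to solving two equations for the bases when the two sequences are given.
\<close>

lemma Phi_eq_iff:
  assumes B: "(q0, q1) \<in> B"
  shows "Phi (q0, q1) = (m, a) \<longleftrightarrow> (m, a) \<in> B' \<and> solves m a q0 q1"
proof -
  note q = B_bounds[OF B]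
  have B_swap: "(q1, q0) \<in> B" using B by (auto simp: B_def mult.commute)
  have THE_iff: "(THE x. P x) = y \<longleftrightarrow> P y" if "P x0" "\<And>x y. P x \<Longrightarrow> P y \<Longrightarrow> x = y"
    for P :: "binseq \<Rightarrow> bool" and x0 y
    using that by (metis the_equality)
  have alpha: "alpha q0 q1 = a \<longleftrightarrow> is_quasi_greedy q0 q1 (rr q0 q1) a"
    unfolding alpha_def
    using quasi_greedy_rr_exists[OF B] by (metis THE_iff quasi_greedy_unique)
  obtain m0 where m0: "is_quasi_greedy q1 q0 (rr q1 q0) (flip m0)"
    using quasi_greedy_rr_exists[OF B_swap] by (metis flip_flip)
  have mu: "mu q0 q1 = m \<longleftrightarrow> is_quasi_greedy q1 q0 (rr q1 q0) (flip m)"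
    unfolding mu_def quasi_lazy_ell_iff[OF q(1,2)]
    using THE_iff[where P = "\<lambda>d. is_quasi_greedy q1 q0 (rr q1 q0) (flip d)", OF m0] by (metis quasi_greedy_unique flip_flip)
  have "nvalue q1 q0 (shift (flip m)) = (q1 - 1) * (q0 - 1) \<longleftrightarrow>
      nvalue q0 q1 (shift m) = 1 - (q0 - 1) * (q1 - 1)"
    using q by (auto simp: flip_shift nvalue_flip mult.commute)
  then show ?thesis
    by (auto simp: Phi_def alpha mu quasi_greedy_rr_iff[OF B] quasi_greedy_rr_iff[OF B_swap]
      B'_iff solves_def)
qed


section \<open>Uniqueness and continuity of the bases\<close>

text \<open>
  Adding the two equations in this form, instead of treating them one by one, gives a function that
  is strictly monotone in each base already by the linear terms.
\<close>

definition balance_sum :: "binseq \<Rightarrow> binseq \<Rightarrow> real \<Rightarrow> real \<Rightarrow> real" where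
  "balance_sum m a q0 q1 = (q0 - 1 - expansion_value q0 q1 (shift a)) +
    (q1 - 1 - expansion_value q1 q0 (flip (shift m)))"

text \<open>
  Comparing the two expressions for \<open>(q0 - 1) * (q1 - 1)\<close> eliminates this product, which is increasing
  in both bases; what remains decreases in \<open>q0\<close> and increases in \<open>q1\<close>.
\<close>

definition balance_diff :: "binseq \<Rightarrow> binseq \<Rightarrow> real \<Rightarrow> real \<Rightarrow> real" where
  "balance_diff m a q0 q1 = nvalue q0 q1 (shift a) + nvalue q0 q1 (shift m) - 1"

text \<open>
  Both summands of \<open>balance_sum\<close> vanish at a solution: in terms of expansion values the two equations
  read \<open>q0 - 1\<close> and \<open>q1 - 1\<close>.
\<close>

lemma solves_balance:
  assumes q: "1 < q0" "1 < q1" and s: "solves m a q0 q1"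
  shows "balance_sum m a q0 q1 = 0" "balance_diff m a q0 q1 = 0"
proof -
  have "expansion_value q0 q1 (shift a) = q0 - 1"
    using s q by (auto simp: solves_def nvalue_def)
  moreover have "nvalue q1 q0 (flip (shift m)) = (q0 - 1) * (q1 - 1)"
    using s q by (simp add: solves_def nvalue_flip)
  then have "expansion_value q1 q0 (flip (shift m)) = q1 - 1"
    using q by (auto simp: nvalue_def)
  ultimately show "balance_sum m a q0 q1 = 0" by (simp add: balance_sum_def)
  show "balance_diff m a q0 q1 = 0" using s by (simp add: balance_diff_def solves_def)
qed

lemma balance_sum_strict_mono:
  assumes "1 < q0" "1 < q1" "q0 \<le> q0'" "q1 \<le> q1'" "q0 + q1 < q0' + q1'"
  shows "balance_sum m a q0 q1 < balance_sum m a q0' q1'"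
  using assms expansion_value_antimono[of q0 q1 q0' q1' "shift a"]
    expansion_value_antimono[of q1 q0 q1' q0' "flip (shift m)"]
  by (simp add: balance_sum_def)

lemma balance_diff_mono:
  assumes "1 < q0'" "q0' \<le> q0" "1 < q1" "q1 \<le> q1'"
  shows "balance_diff m a q0 q1 \<le> balance_diff m a q0' q1'"
  using nvalue_mono[OF assms, of "shift a"] nvalue_mono[OF assms, of "shift m"]
  by (simp add: balance_diff_def)

text \<open>
  The digit pattern that makes the value of the sequence depend strictly on \<open>q0\<close>.
\<close>

lemma self_maximal_zero_then_one:
  assumes "self_maximal d"
  obtains n k where "n < k" "\<not> shift d n" "shift d k"
proof -
  have d: "d 0" "\<not> finite_seq d" "d \<noteq> const_seq True" using assms by (auto simp: self_maximal_def)
  then obtain i where i: "\<not> d i" by (auto simp: const_seq_def fun_eq_iff)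
  with d have "i \<noteq> 0" by metis
  obtain k where k: "k \<ge> i" "d k" using infinite_seq_ones[OF d(2,1)] by blast
  with i have "i < k" by (metis le_neq_implies_less)
  then show ?thesis
    using that[of "i - 1" "k - 1"] i k \<open>i \<noteq> 0\<close> by (simp add: shift_apply)
qed

lemma B'_shift_digits:
  assumes "(m, a) \<in> B'"
  obtains i j k l where "i < j" "\<not> shift a i" "shift a j" "k < l" "shift m k" "\<not> shift m l"
proof -
  have max: "self_maximal (flip m)" "self_maximal a" using assms by (auto simp: B'_iff)
  obtain i j where "i < j" "\<not> shift a i" "shift a j"
    by (rule self_maximal_zero_then_one[OF max(2)])
  moreover obtain k l where "k < l" "shift m k" "\<not> shift m l"
    by (rule self_maximal_zero_then_one[OF max(1)]) (auto simp: flip_shift flip_apply)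
  ultimately show ?thesis using that by blast
qed

text \<open>
  A change of \<open>q0\<close> is felt strictly by the second sequence, a change of \<open>q1\<close> by the first one.
\<close>

lemma balance_diff_strict_mono:
  assumes q: "1 < q0'" "q0' \<le> q0" "1 < q1" "q1 \<le> q1'" "q0' < q0 \<or> q1 < q1'"
    and ma: "(m, a) \<in> B'"
  shows "balance_diff m a q0 q1 < balance_diff m a q0' q1'"
  using q(5)
proof
  assume "q0' < q0"
  moreover obtain n k where "n < k" "\<not> shift a n" "shift a k"
    using B'_shift_digits[OF ma] by metis
  ultimately have "nvalue q0 q1 (shift a) < nvalue q0' q1' (shift a)"
    using q by (intro nvalue_strict_mono_q0[of q0' q0 q1 q1' _ n k]) auto
  then show ?thesis
    using nvalue_mono[OF q(1-4), of "shift m"] by (simp add: balance_diff_def)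
next
  assume "q1 < q1'"
  moreover obtain n k where "n < k" "shift m n" "\<not> shift m k"
    using B'_shift_digits[OF ma] by metis
  ultimately have "nvalue q0 q1 (shift m) < nvalue q0' q1' (shift m)"
    using q by (intro nvalue_strict_mono_q1[of q0' q0 q1 q1' _ n k]) auto
  then show ?thesis
    using nvalue_mono[OF q(1-4), of "shift a"] by (simp add: balance_diff_def)
qed

text \<open>
  For fixed bases the value of a sequence changes little when only late digits change.
\<close>

lemma balance_stable:
  assumes q: "1 < q0" "1 < q1" and nz: "balance_sum m a q0 q1 \<noteq> 0" "balance_diff m a q0 q1 \<noteq> 0"
  obtains N where "\<And>m' a'. \<forall>i<N. m' i = m i \<and> a' i = a i \<Longrightarrow>
    sgn (balance_sum m' a' q0 q1) = sgn (balance_sum m a q0 q1) \<and>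
    sgn (balance_diff m' a' q0 q1) = sgn (balance_diff m a q0 q1)"
proof -
  define K where "K = 2 + 1 / (q0 - 1) + 1 / (q1 - 1)"
  define \<eta> where "\<eta> = min \<bar>balance_sum m a q0 q1\<bar> \<bar>balance_diff m a q0 q1\<bar>"
  have K: "0 < K" "2 \<le> K" "1 / (q0 - 1) + 1 / (q1 - 1) \<le> K" using q by (auto simp: K_def add_pos_pos)
  have \<eta>: "0 < \<eta>" "\<eta> \<le> \<bar>balance_sum m a q0 q1\<bar>" "\<eta> \<le> \<bar>balance_diff m a q0 q1\<bar>"
    using nz by (auto simp: \<eta>_def)
  have "(\<lambda>n. K * (1 / min q0 q1) ^ n) \<longlonglongrightarrow> K * 0"
    using q by (intro tendsto_intros LIMSEQ_power_zero) auto
  then have "\<forall>\<^sub>F n in sequentially. K * (1 / min q0 q1) ^ n < \<eta>"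
    using \<eta> by (auto dest: order_tendstoD(2))
  then obtain n where n: "K * (1 / min q0 q1) ^ n < \<eta>" by (auto simp: eventually_sequentially)
  define r where "r = (1 / min q0 q1) ^ n"
  have r: "0 \<le> r" using q by (simp add: r_def)
  show ?thesis
  proof (rule that[of "Suc n"])
    fix m' a' assume eq: "\<forall>i<Suc n. m' i = m i \<and> a' i = a i"
    have a: "\<bar>nvalue q0 q1 (shift a') - nvalue q0 q1 (shift a)\<bar> \<le> r"
      unfolding r_def using eq by (intro nvalue_close q) (simp add: shift_apply)
    have m: "\<bar>nvalue q0 q1 (shift m') - nvalue q0 q1 (shift m)\<bar> \<le> r"
      unfolding r_def using eq by (intro nvalue_close q) (simp add: shift_apply)
    have "\<bar>balance_diff m' a' q0 q1 - balance_diff m a q0 q1\<bar> \<le> 2 * r"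
      using a m by (simp add: balance_diff_def)
    also have "2 * r \<le> K * r" using K r by (intro mult_right_mono)
    finally have D: "\<bar>balance_diff m' a' q0 q1 - balance_diff m a q0 q1\<bar> < \<eta>"
      using n by (simp add: r_def)
    have ev: "expansion_value q0 q1 d = nvalue q0 q1 d / (q1 - 1)"
        "expansion_value q1 q0 (flip d) = (1 - nvalue q0 q1 d) / (q0 - 1)" for d
      using q nvalue_flip[of q1 q0 d] by (auto simp: nvalue_def field_simps)
    have "balance_sum m' a' q0 q1 - balance_sum m a q0 q1 =
        (nvalue q0 q1 (shift m') - nvalue q0 q1 (shift m)) / (q0 - 1)
        - (nvalue q0 q1 (shift a') - nvalue q0 q1 (shift a)) / (q1 - 1)"
      by (simp add: balance_sum_def ev diff_divide_distrib)
    also have "\<bar>\<dots>\<bar> \<le> \<bar>(nvalue q0 q1 (shift m') - nvalue q0 q1 (shift m)) / (q0 - 1)\<bar>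
        + \<bar>(nvalue q0 q1 (shift a') - nvalue q0 q1 (shift a)) / (q1 - 1)\<bar>"
      by (rule abs_triangle_ineq4)
    also have "\<dots> \<le> r / (q0 - 1) + r / (q1 - 1)"
      unfolding abs_divide using q a m by (intro add_mono frac_le) auto
    also have "\<dots> = (1 / (q0 - 1) + 1 / (q1 - 1)) * r"
      by (simp add: distrib_right)
    also have "\<dots> \<le> K * r" using K r by (intro mult_right_mono)
    finally have S: "\<bar>balance_sum m' a' q0 q1 - balance_sum m a q0 q1\<bar> < \<eta>"
      using n by (simp add: r_def)
    have sgn_eq: "sgn x = sgn y" if "\<bar>x - y\<bar> < \<eta>" "\<eta> \<le> \<bar>y\<bar>" for x y :: real
      using that by (auto simp: sgn_if abs_if split: if_splits)
    show "sgn (balance_sum m' a' q0 q1) = sgn (balance_sum m a q0 q1) \<and>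
        sgn (balance_diff m' a' q0 q1) = sgn (balance_diff m a q0 q1)"
      using sgn_eq[OF S \<eta>(2)] sgn_eq[OF D \<eta>(3)] by simp
  qed
qed

lemma solution_avoids_quadrants:
  assumes q: "1 < q0" "1 < q1" and c: "1 < c0" "1 < c1" and s: "solves m a q0 q1"
  shows "0 < balance_sum m a c0 c1 \<Longrightarrow> \<not> (c0 \<le> q0 \<and> c1 \<le> q1)"
    and "balance_sum m a c0 c1 < 0 \<Longrightarrow> \<not> (q0 \<le> c0 \<and> q1 \<le> c1)"
    and "0 < balance_diff m a c0 c1 \<Longrightarrow> \<not> (q0 \<le> c0 \<and> c1 \<le> q1)"
    and "balance_diff m a c0 c1 < 0 \<Longrightarrow> \<not> (c0 \<le> q0 \<and> q1 \<le> c1)"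
proof -
  note z = solves_balance[OF q s]
  show "\<not> (c0 \<le> q0 \<and> c1 \<le> q1)" if "0 < balance_sum m a c0 c1"
    using balance_sum_strict_mono[of c0 c1 q0 q1 m a] that z c
    by (cases "q0 = c0 \<and> q1 = c1") force+
  show "\<not> (q0 \<le> c0 \<and> q1 \<le> c1)" if "balance_sum m a c0 c1 < 0"
    using balance_sum_strict_mono[of q0 q1 c0 c1 m a] that z q
    by (cases "q0 = c0 \<and> q1 = c1") force+
  show "\<not> (q0 \<le> c0 \<and> c1 \<le> q1)" if "0 < balance_diff m a c0 c1"
    using balance_diff_mono[of q0 c0 c1 q1 m a] that z q c by auto
  show "\<not> (c0 \<le> q0 \<and> q1 \<le> c1)" if "balance_diff m a c0 c1 < 0"
    using balance_diff_mono[of c0 q0 q1 c1 m a] that z q c by auto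
qed

text \<open>
  The points \<open>(q0, q1 \<plusminus> \<delta>)\<close> and \<open>(q0 \<plusminus> \<delta>, q1)\<close> are used. At the point \<open>(q0, q1 + \<delta>)\<close>, for
  instance, both functions are positive, so \<open>solution_avoids_quadrants\<close> forbids the quadrants to the
  upper right and to the upper left, that is, the whole half-plane above it; the other three
  points exclude the other three half-planes. All of this persists for sequences agreeing long
  enough with the given ones.
\<close>

lemma solution_stable:
  assumes q: "1 < q0" "1 < q1" and s: "solves m a q0 q1" and ma: "(m, a) \<in> B'" and \<epsilon>: "0 < \<epsilon>"
  obtains N where "\<And>m' a' q0' q1'. \<forall>i<N. m' i = m i \<and> a' i = a i \<Longrightarrow> 1 < q0' \<Longrightarrow> 1 < q1' \<Longrightarrow>
    solves m' a' q0' q1' \<Longrightarrow> \<bar>q0' - q0\<bar> < \<epsilon> \<and> \<bar>q1' - q1\<bar> < \<epsilon>"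
proof -
  define \<delta> where "\<delta> = min \<epsilon> (min ((q0 - 1) / 2) ((q1 - 1) / 2))"
  have "\<delta> \<le> (q0 - 1) / 2" "\<delta> \<le> (q1 - 1) / 2" unfolding \<delta>_def by linarith+
  then have \<delta>: "0 < \<delta>" "\<delta> \<le> \<epsilon>" "1 < q0 - \<delta>" "1 < q1 - \<delta>"
    using q \<epsilon> by (auto simp: \<delta>_def)
  note z = solves_balance[OF q s]
  have up: "0 < balance_sum m a q0 (q1 + \<delta>)" "0 < balance_diff m a q0 (q1 + \<delta>)"
    using balance_sum_strict_mono[of q0 q1 q0 "q1 + \<delta>" m a]
      balance_diff_strict_mono[of q0 q0 q1 "q1 + \<delta>" m a] z q \<delta> ma by auto
  have down: "balance_sum m a q0 (q1 - \<delta>) < 0" "balance_diff m a q0 (q1 - \<delta>) < 0"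
    using balance_sum_strict_mono[of q0 "q1 - \<delta>" q0 q1 m a]
      balance_diff_strict_mono[of q0 q0 "q1 - \<delta>" q1 m a] z q \<delta> ma by auto
  have right: "0 < balance_sum m a (q0 + \<delta>) q1" "balance_diff m a (q0 + \<delta>) q1 < 0"
    using balance_sum_strict_mono[of q0 q1 "q0 + \<delta>" q1 m a]
      balance_diff_strict_mono[of q0 "q0 + \<delta>" q1 q1 m a] z q \<delta> ma by auto
  have left: "balance_sum m a (q0 - \<delta>) q1 < 0" "0 < balance_diff m a (q0 - \<delta>) q1"
    using balance_sum_strict_mono[of "q0 - \<delta>" q1 q0 q1 m a]
      balance_diff_strict_mono[of "q0 - \<delta>" q0 q1 q1 m a] z q \<delta> ma by auto
  obtain N1 where N1: "\<And>m' a'. \<forall>i<N1. m' i = m i \<and> a' i = a i \<Longrightarrow>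
      0 < balance_sum m' a' q0 (q1 + \<delta>) \<and> 0 < balance_diff m' a' q0 (q1 + \<delta>)"
    by (rule balance_stable[of q0 "q1 + \<delta>" m a])
      (use up q \<delta> in \<open>auto simp: sgn_1_pos sgn_1_neg\<close>)
  obtain N2 where N2: "\<And>m' a'. \<forall>i<N2. m' i = m i \<and> a' i = a i \<Longrightarrow>
      balance_sum m' a' q0 (q1 - \<delta>) < 0 \<and> balance_diff m' a' q0 (q1 - \<delta>) < 0"
    by (rule balance_stable[of q0 "q1 - \<delta>" m a])
      (use down q \<delta> in \<open>auto simp: sgn_1_pos sgn_1_neg\<close>)
  obtain N3 where N3: "\<And>m' a'. \<forall>i<N3. m' i = m i \<and> a' i = a i \<Longrightarrow>
      0 < balance_sum m' a' (q0 + \<delta>) q1 \<and> balance_diff m' a' (q0 + \<delta>) q1 < 0"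
    by (rule balance_stable[of "q0 + \<delta>" q1 m a])
      (use right q \<delta> in \<open>auto simp: sgn_1_pos sgn_1_neg\<close>)
  obtain N4 where N4: "\<And>m' a'. \<forall>i<N4. m' i = m i \<and> a' i = a i \<Longrightarrow>
      balance_sum m' a' (q0 - \<delta>) q1 < 0 \<and> 0 < balance_diff m' a' (q0 - \<delta>) q1"
    by (rule balance_stable[of "q0 - \<delta>" q1 m a])
      (use left q \<delta> in \<open>auto simp: sgn_1_pos sgn_1_neg\<close>)
  show ?thesis
  proof (rule that[of "max (max N1 N2) (max N3 N4)"])
    fix m' a' q0' q1'
    assume eq: "\<forall>i<max (max N1 N2) (max N3 N4). m' i = m i \<and> a' i = a i"
      and q': "1 < q0'" "1 < q1'" and s': "solves m' a' q0' q1'"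
    note avoid = solution_avoids_quadrants[OF q' _ _ s']
    have "\<not> q1 + \<delta> \<le> q1'"
      using avoid(1,3)[of q0 "q1 + \<delta>"] N1[of m' a'] eq q \<delta> by (auto simp: less_max_iff_disj)
    moreover have "\<not> q1' \<le> q1 - \<delta>"
      using avoid(2,4)[of q0 "q1 - \<delta>"] N2[of m' a'] eq q \<delta> by (auto simp: less_max_iff_disj)
    moreover have "\<not> q0 + \<delta> \<le> q0'"
      using avoid(1,4)[of "q0 + \<delta>" q1] N3[of m' a'] eq q \<delta> by (auto simp: less_max_iff_disj)
    moreover have "\<not> q0' \<le> q0 - \<delta>"
      using avoid(2,3)[of "q0 - \<delta>" q1] N4[of m' a'] eq q \<delta> by (auto simp: less_max_iff_disj)
    ultimately show "\<bar>q0' - q0\<bar> < \<epsilon> \<and> \<bar>q1' - q1\<bar> < \<epsilon>"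
      using \<delta> by auto
  qed
qed

lemma solution_unique:
  assumes ma: "(m, a) \<in> B'"
    and q: "1 < q0" "1 < q1" "solves m a q0 q1" and q': "1 < q0'" "1 < q1'" "solves m a q0' q1'"
  shows "q0' = q0" "q1' = q1"
proof -
  have "\<bar>q0' - q0\<bar> < \<epsilon> \<and> \<bar>q1' - q1\<bar> < \<epsilon>" if "0 < \<epsilon>" for \<epsilon>
    by (rule solution_stable[OF q ma that]) (use q' in blast)
  from this[of "\<bar>q0' - q0\<bar>"] this[of "\<bar>q1' - q1\<bar>"] show "q0' = q0" "q1' = q1" by auto
qed

section \<open>Existence of the bases\<close>

lemma tendsto_nvalue:
  assumes f: "(f \<longlongrightarrow> q0) F" "(g \<longlongrightarrow> q1) F" and q: "1 < q0" "1 < q1"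
  shows "((\<lambda>x. nvalue (f x) (g x) d) \<longlongrightarrow> nvalue q0 q1 d) F"
proof (rule LIM_zero_cancel, rule Lim_null_comparison)
  have "\<forall>\<^sub>F x in F. 1 < f x" "\<forall>\<^sub>F x in F. 1 < g x"
    using order_tendstoD(1)[OF f(1) q(1)] order_tendstoD(1)[OF f(2) q(2)] by auto
  then show "\<forall>\<^sub>F x in F. norm (nvalue (f x) (g x) d - nvalue q0 q1 d)
      \<le> (\<bar>1 / q0 - 1 / f x\<bar> + \<bar>1 / q1 - 1 / g x\<bar>) / (1 - 1 / min q0 q1)"
  proof eventually_elim
    case (elim x)
    then show ?case
      using nvalue_lipschitz[OF q, of "f x" "g x" d] by (simp add: abs_minus_commute)
  qed
  have "((\<lambda>x. (\<bar>1 / q0 - 1 / f x\<bar> + \<bar>1 / q1 - 1 / g x\<bar>) / (1 - 1 / min q0 q1)) \<longlongrightarrow>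
      (\<bar>1 / q0 - 1 / q0\<bar> + \<bar>1 / q1 - 1 / q1\<bar>) / (1 - 1 / min q0 q1)) F"
    using q by (intro tendsto_intros f) auto
  then show "((\<lambda>x. (\<bar>1 / q0 - 1 / f x\<bar> + \<bar>1 / q1 - 1 / g x\<bar>) / (1 - 1 / min q0 q1)) \<longlongrightarrow> 0) F"
    by simp
qed

lemma continuous_on_nvalue:
  assumes "continuous_on S f" "continuous_on S g" "\<And>x. x \<in> S \<Longrightarrow> 1 < f x" "\<And>x. x \<in> S \<Longrightarrow> 1 < g x"
  shows "continuous_on S (\<lambda>x. nvalue (f x) (g x) d)"
  using assms unfolding continuous_on_def by (auto intro!: tendsto_nvalue)

text \<open>
  Strict monotonicity in the second variable replaces differentiability: the sign of \<open>S r t\<close> tells on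
  which side of \<open>t\<close> the zero lies, and by continuity this sign is the same for all \<open>r\<close> near \<open>p\<close>.
\<close>

lemma continuous_on_implicit:
  fixes S :: "real \<Rightarrow> real \<Rightarrow> real" and \<tau> :: "real \<Rightarrow> real"
  assumes mono: "\<And>p t t'. p \<in> I \<Longrightarrow> 0 < t \<Longrightarrow> t < t' \<Longrightarrow> S p t < S p t'"
    and cont: "\<And>t. 0 < t \<Longrightarrow> continuous_on I (\<lambda>p. S p t)"
    and zero: "\<And>p. p \<in> I \<Longrightarrow> 0 < \<tau> p \<and> S p (\<tau> p) = 0"
  shows "continuous_on I \<tau>"
  unfolding continuous_on_def
proof (intro ballI order_tendstoI)
  fix p y assume p: "p \<in> I" and y: "y < \<tau> p"
  define t where "t = max y (\<tau> p / 2)"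
  have t: "0 < t" "t < \<tau> p" "y \<le> t" using y zero[OF p] by (auto simp: t_def)
  have "S p t < 0" using mono[OF p t(1,2)] zero[OF p] by simp
  then have "\<forall>\<^sub>F r in at p within I. S r t < 0"
    using cont[OF t(1)] p by (auto simp: continuous_on_def intro: order_tendstoD)
  moreover have "\<forall>\<^sub>F r in at p within I. r \<in> I"
    by (simp add: eventually_at_filter)
  ultimately show "\<forall>\<^sub>F r in at p within I. y < \<tau> r"
  proof eventually_elim
    case (elim r)
    then have "\<not> \<tau> r \<le> t" using mono[of r "\<tau> r" t] zero[of r] by (cases "\<tau> r = t") auto
    then show ?case using t by simp
  qed
next
  fix p y assume p: "p \<in> I" and y: "\<tau> p < y"
  have y0: "0 < y" using y zero[OF p] by simp
  have "0 < S p y" using mono[of p "\<tau> p" y] p y zero[OF p] by simp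
  then have "\<forall>\<^sub>F r in at p within I. 0 < S r y"
    using cont[OF y0] p by (auto simp: continuous_on_def intro: order_tendstoD)
  moreover have "\<forall>\<^sub>F r in at p within I. r \<in> I"
    by (simp add: eventually_at_filter)
  ultimately show "\<forall>\<^sub>F r in at p within I. \<tau> r < y"
  proof eventually_elim
    case (elim r)
    then have "\<not> y \<le> \<tau> r" using mono[of r y "\<tau> r"] y0 zero[of r] by (cases "\<tau> r = y") auto
    then show ?case by simp
  qed
qed

text \<open>
  The right-hand side is the lower bound of \<open>nvalue_lower_bound\<close> at the point
  \<open>(1 + p / t, 1 + t)\<close> of the hyperbola, and it tends to 1.
\<close>

lemma eventually_nvalue_bound:
  fixes p :: real
  shows "\<forall>\<^sub>F t in at_top. 1 / 2 < (1 / (1 + p / t)) ^ j * (1 - 1 / (1 + t))"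
proof (rule order_tendstoD(1))
  have inv: "((\<lambda>t. p / t) \<longlongrightarrow> 0) at_top"
    by (intro tendsto_divide_0[OF tendsto_const] filterlim_at_top_imp_at_infinity filterlim_ident)
  have inv1: "((\<lambda>t::real. 1 / (1 + t)) \<longlongrightarrow> 0) at_top"
    by (intro tendsto_divide_0[OF tendsto_const] filterlim_at_top_imp_at_infinity
        filterlim_tendsto_add_at_top[OF tendsto_const] filterlim_ident)
  have "((\<lambda>t. (1 / (1 + p / t)) ^ j * (1 - 1 / (1 + t))) \<longlongrightarrow> (1 / (1 + 0)) ^ j * (1 - 0)) at_top"
    by (intro tendsto_intros inv inv1) auto
  then show "((\<lambda>t. (1 / (1 + p / t)) ^ j * (1 - 1 / (1 + t))) \<longlongrightarrow> 1) at_top" by simp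
qed simp

text \<open>
  Towards the end \<open>t \<rightarrow> \<infinity>\<close> of the hyperbola all values of sequences containing a 1 tend to 1, towards
  \<open>t \<rightarrow> 0\<close> all values of sequences containing a 0 tend to 0. Hence \<open>balance_diff\<close> changes its sign.
\<close>

lemma hyperbola_zero:
  assumes ma: "(m, a) \<in> B'" and p: "0 < p" "p \<le> 1"
  shows "\<exists>t>0. balance_diff m a (1 + p / t) (1 + t) = 0"
proof -
  obtain j j' k k' where j: "\<not> shift a j" "shift a j'" and k: "shift m k" "\<not> shift m k'"
    using B'_shift_digits[OF ma] by metis
  have "\<forall>\<^sub>F t in at_top. 1 / 2 < (1 / (1 + p / t)) ^ j * (1 - 1 / (1 + t)) \<and>
      1 / 2 < (1 / (1 + p / t)) ^ j' * (1 - 1 / (1 + t)) \<and>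
      1 / 2 < (1 / (1 + p / t)) ^ k * (1 - 1 / (1 + t)) \<and>
      1 / 2 < (1 / (1 + p / t)) ^ k' * (1 - 1 / (1 + t)) \<and> 1 \<le> t"
    by (intro eventually_conj eventually_nvalue_bound eventually_ge_at_top)
  then obtain t where t: "1 / 2 < (1 / (1 + p / t)) ^ j * (1 - 1 / (1 + t))"
      "1 / 2 < (1 / (1 + p / t)) ^ j' * (1 - 1 / (1 + t))"
      "1 / 2 < (1 / (1 + p / t)) ^ k * (1 - 1 / (1 + t))"
      "1 / 2 < (1 / (1 + p / t)) ^ k' * (1 - 1 / (1 + t))" "1 \<le> t"
    by (auto simp: eventually_at_top_linorder)
  \<comment> \<open>\<open>t \<mapsto> p / t\<close> exchanges the two bases on the hyperbola, so \<open>p / t\<close> and \<open>t\<close> serve as end points\<close>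
  define D where "D t = balance_diff m a (1 + p / t) (1 + t)" for t
  have pt: "0 < p / t" using p t by simp
  have low: "1 / 2 < nvalue (1 + p / t) (1 + t) d"
    if "1 / 2 < (1 / (1 + p / t)) ^ i * (1 - 1 / (1 + t))" "d i" for d i
    by (rule less_le_trans[OF that(1) nvalue_lower_bound]) (use that t pt in auto)
  have "0 < D t"
    using low[of j' "shift a"] low[of k "shift m"] t j k by (simp add: D_def balance_diff_def)
  have "1 / 2 < nvalue (1 + p / t) (1 + t) (flip (shift a))"
      "1 / 2 < nvalue (1 + p / t) (1 + t) (flip (shift m))"
    using low[of j "flip (shift a)"] low[of k' "flip (shift m)"] t j k
    by (auto simp: flip_apply)
  then have "D (p / t) < 0"
    using p t pt by (simp add: D_def balance_diff_def nvalue_flip)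
  moreover have "p / t \<le> t"
  proof -
    have "p / t \<le> 1" using p t by simp
    then show ?thesis using t(5) by linarith
  qed
  moreover have "continuous_on {p / t..t} D"
    unfolding D_def balance_diff_def using p pt
    by (intro continuous_intros continuous_on_nvalue) (auto intro!: divide_pos_pos)
  ultimately obtain s where "p / t \<le> s" "D s = 0"
    using IVT'[of D "p / t" 0 t] \<open>0 < D t\<close> by auto
  then show ?thesis using pt unfolding D_def by (intro exI[of _ s]) auto
qed

text \<open>
  After division by \<open>v\<close> the claim is about the expansion value, which is at least
  \<open>1 / ((1 + u) ^ j * (1 + v))\<close>; it exceeds \<open>u\<close> because \<open>u * (1 + v) = u + \<epsilon>\<^sup>2 \<le> 2 * \<epsilon>\<close> and
  \<open>(1 + u) ^ j \<le> 2 ^ j\<close>.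
\<close>

lemma nvalue_exceeds_product:
  assumes u: "0 < u" "u \<le> \<epsilon>" and v: "0 < v" and p: "u * v = \<epsilon>\<^sup>2" and \<epsilon>: "\<epsilon> \<le> 1" "2 * \<epsilon> < (1 / 2) ^ j"
    and d: "d j"
  shows "u * v < nvalue (1 + u) (1 + v) d"
proof -
  have "u * (1 + v) = u + \<epsilon>\<^sup>2" using p by (simp add: algebra_simps)
  also have "\<dots> \<le> \<epsilon> + \<epsilon> * 1"
    using u \<epsilon> unfolding power2_eq_square by (intro add_mono mult_left_mono) auto
  also have "\<dots> < (1 / 2) ^ j" using \<epsilon> by simp
  also have "\<dots> \<le> (1 / (1 + u)) ^ j"
    using u \<epsilon> by (intro power_mono divide_left_mono) auto
  finally have "u * (1 + v) * (v / (1 + v)) < (1 / (1 + u)) ^ j * (v / (1 + v))"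
    using v by (intro mult_strict_right_mono) auto
  moreover have "u * (1 + v) * (v / (1 + v)) = u * v"
    using v by simp
  moreover have eq: "v / (1 + v) = 1 - 1 / (1 + v)"
    using v by (simp add: field_simps)
  have "(1 / (1 + u)) ^ j * (v / (1 + v)) \<le> nvalue (1 + u) (1 + v) d"
    unfolding eq using u v d by (intro nvalue_lower_bound) auto
  ultimately show ?thesis by linarith
qed

text \<open>
  Follow the zero \<open>\<tau> p\<close> of \<open>balance_diff\<close> on the hyperbola with parameter \<open>p\<close>, from \<open>p = \<epsilon>\<^sup>2\<close> to \<open>p = 1\<close>. On the
  hyperbola of \<open>\<epsilon>\<^sup>2\<close> one of the bases is at most \<open>1 + \<epsilon>\<close>; depending on which one, the lower bound for
  small \<open>p\<close> is applied to the second sequence or to the mirror image of the first.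
\<close>

lemma solution_exists:
  assumes ma: "(m, a) \<in> B'"
  obtains q0 q1 where "(q0, q1) \<in> B" "solves m a q0 q1"
proof -
  obtain j0 j k where j: "\<not> shift a j0" "shift a j" and k: "\<not> shift m k"
    using B'_shift_digits[OF ma] by metis
  define \<tau> where "\<tau> p = (SOME t. 0 < t \<and> balance_diff m a (1 + p / t) (1 + t) = 0)" for p
  have \<tau>: "0 < \<tau> p \<and> balance_diff m a (1 + p / \<tau> p) (1 + \<tau> p) = 0" if "0 < p" "p \<le> 1" for p
    unfolding \<tau>_def by (rule someI_ex) (use hyperbola_zero[OF ma that] in blast)
  \<comment> \<open>the largest power of \<open>1 / 2\<close> with \<open>2 * \<epsilon> < (1 / 2) ^ i\<close> for both positions \<open>i\<close>\<close>
  define \<epsilon> :: real where "\<epsilon> = (1 / 2) ^ (max j k + 2)"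
  have \<epsilon>: "0 < \<epsilon>" "\<epsilon> \<le> 1" unfolding \<epsilon>_def by (simp, intro power_le_one) auto
  have \<epsilon>_less: "2 * \<epsilon> < (1 / 2) ^ i" if "i \<le> max j k" for i
  proof -
    have "2 * \<epsilon> = (1 / 2) ^ max j k / 2" by (simp add: \<epsilon>_def power2_eq_square)
    then have "2 * \<epsilon> < (1 / 2) ^ max j k" using \<epsilon>(1) by linarith
    also have "\<dots> \<le> (1 / 2) ^ i" using that by (intro power_decreasing) auto
    finally show ?thesis .
  qed
  have \<epsilon>2: "0 < \<epsilon>\<^sup>2" "\<epsilon>\<^sup>2 \<le> 1" using \<epsilon> by (auto simp: power_le_one)
  let ?I = "{\<epsilon>\<^sup>2..1}"
  have I: "0 < p" "p \<le> 1" if "p \<in> ?I" for p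
    using that \<epsilon>2(1) unfolding atLeastAtMost_iff by linarith+
  have \<tau>_cont: "continuous_on ?I \<tau>"
  proof (rule continuous_on_implicit[where S = "\<lambda>p t. balance_diff m a (1 + p / t) (1 + t)"])
    show "balance_diff m a (1 + p / t) (1 + t) < balance_diff m a (1 + p / t') (1 + t')"
      if "p \<in> ?I" "0 < t" "t < t'" for p t t'
      using that I[OF that(1)] by (intro balance_diff_strict_mono ma) (auto intro!: divide_left_mono mult_pos_pos)
    show "continuous_on ?I (\<lambda>p. balance_diff m a (1 + p / t) (1 + t))" if t: "0 < t" for t
    proof -
      have "t \<noteq> 0" "1 < 1 + p / t" "1 < 1 + t" if "p \<in> ?I" for p
        using I(1)[OF that] t by simp_all
      then show ?thesis
        unfolding balance_diff_def by (intro continuous_intros continuous_on_nvalue) (use t in blast)+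
    qed
    show "0 < \<tau> p \<and> balance_diff m a (1 + p / \<tau> p) (1 + \<tau> p) = 0" if "p \<in> ?I" for p
      by (rule \<tau>[OF I(1)[OF that] I(2)[OF that]])
  qed
  define \<phi> where "\<phi> p = nvalue (1 + p / \<tau> p) (1 + \<tau> p) (shift a) - p" for p
  have \<phi>_cont: "continuous_on ?I \<phi>"
  proof -
    have "0 < \<tau> p" "\<tau> p \<noteq> 0" "1 < 1 + p / \<tau> p" "1 < 1 + \<tau> p" if "p \<in> ?I" for p
      using \<tau>[OF I(1)[OF that] I(2)[OF that]] I(1)[OF that] by auto
    then show ?thesis
      unfolding \<phi>_def by (intro continuous_intros continuous_on_nvalue \<tau>_cont) blast+
  qed
  \<comment> \<open>the hyperbola \<open>p = 1\<close> is the boundary of \<open>B\<close>, where the value would have to be 1\<close>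
  have "\<phi> 1 < 0"
    using nvalue_less_1[of "1 + 1 / \<tau> 1" "1 + \<tau> 1" "shift a" j0] \<tau>[of 1] j by (simp add: \<phi>_def)
  moreover have "0 < \<phi> (\<epsilon>\<^sup>2)"
  proof -
    define v where "v = \<tau> (\<epsilon>\<^sup>2)"
    define u where "u = \<epsilon>\<^sup>2 / v"
    have v: "0 < v" and D: "balance_diff m a (1 + u) (1 + v) = 0"
      using \<tau>[of "\<epsilon>\<^sup>2"] \<epsilon>2 by (auto simp: u_def v_def)
    have u: "0 < u" "u * v = \<epsilon>\<^sup>2" using v \<epsilon>2 by (auto simp: u_def)
    have "u * v < nvalue (1 + u) (1 + v) (shift a)"
    proof (cases "u \<le> \<epsilon>")
      case True
      then show ?thesis using u v \<epsilon> \<epsilon>_less[of j] j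
        by (intro nvalue_exceeds_product[where \<epsilon> = \<epsilon> and j = j]) auto
    next
      case False
      have "v \<le> \<epsilon>"
      proof (rule ccontr)
        assume "\<not> v \<le> \<epsilon>"
        then have "\<epsilon> * \<epsilon> < u * v" using False \<epsilon> by (intro mult_strict_mono) auto
        then show False using u by (simp add: power2_eq_square)
      qed
      then have "v * u < nvalue (1 + v) (1 + u) (flip (shift m))"
        using u v \<epsilon> \<epsilon>_less[of k] k
        by (intro nvalue_exceeds_product[where \<epsilon> = \<epsilon> and j = k]) (auto simp: mult.commute[of v] flip_apply)
      then show ?thesis
        using D u v by (simp add: nvalue_flip balance_diff_def mult.commute)
    qed
    then show ?thesis using u by (simp add: \<phi>_def u_def v_def)
  qed
  ultimately obtain p where p: "\<epsilon>\<^sup>2 \<le> p" "p \<le> 1" "\<phi> p = 0"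
    using IVT2'[of \<phi> 1 0 "\<epsilon>\<^sup>2"] \<epsilon>2 \<phi>_cont by auto
  then have "0 < p" using \<epsilon>2(1) by linarith
  define q0 q1 where "q0 = 1 + p / \<tau> p" and "q1 = 1 + \<tau> p"
  have t: "0 < \<tau> p" "balance_diff m a q0 q1 = 0"
    using \<tau>[of p] p \<open>0 < p\<close> by (auto simp: q0_def q1_def)
  then have q: "1 < q0" "1 < q1" using \<open>0 < p\<close> by (auto simp: q0_def q1_def)
  have prod: "(q0 - 1) * (q1 - 1) = p" using t by (simp add: q0_def q1_def)
  have A: "nvalue q0 q1 (shift a) = p" using p by (simp add: \<phi>_def q0_def q1_def)
  \<comment> \<open>the solution lies in \<open>B\<close>, which is the region \<open>p < 1\<close>\<close>
  have "p < 1" using nvalue_less_1[of q0 q1 "shift a" j0] q A j by simp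
  then have "q0 * q1 < q0 + q1" using prod by (simp add: algebra_simps)
  then have "(q0, q1) \<in> B" using q by (simp add: B_def)
  moreover have "solves m a q0 q1"
    using A t prod by (simp add: solves_def balance_diff_def)
  ultimately show ?thesis using that by blast
qed

section \<open>The coding map is bijective with continuous inverse\<close>

lemma seq_dist_less_imp_eq:
  assumes "seq_dist c e < (1 / 2) ^ N" "i < N"
  shows "c i = e i"
proof (rule ccontr)
  assume ne: "c i \<noteq> e i"
  then have "(LEAST i. c i \<noteq> e i) \<le> i" by (rule Least_le)
  then have "(1 / 2 :: real) ^ N \<le> (1 / 2) ^ Suc (LEAST i. c i \<noteq> e i)"
    using assms(2) by (intro power_decreasing) auto
  moreover have "c \<noteq> e" using ne by auto
  ultimately show False using assms(1) unfolding seq_dist_def by (simp only: if_False)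
qed

lemma bij_betw_Phi: "bij_betw Phi B B'"
  unfolding bij_betw_def
proof (intro conjI inj_onI set_eqI iffI)
  fix x y assume x: "x \<in> B" "y \<in> B" "Phi x = Phi y"
  obtain q0 q1 q0' q1' m a where xy: "x = (q0, q1)" "y = (q0', q1')" "Phi x = (m, a)"
    by (metis surj_pair)
  then have "Phi (q0, q1) = (m, a)" "Phi (q0', q1') = (m, a)" using x(3) by simp_all
  then have "(m, a) \<in> B'" "solves m a q0 q1" "solves m a q0' q1'"
    using Phi_eq_iff x(1,2) xy(1,2) by auto
  then show "x = y"
    using solution_unique[of m a q0' q1' q0 q1] x B_bounds(1,2) unfolding xy by auto
next
  fix s assume "s \<in> Phi ` B"
  then show "s \<in> B'" using Phi_eq_iff by (metis imageE surj_pair)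
next
  fix s assume "s \<in> B'"
  then obtain m a where s: "s = (m, a)" "(m, a) \<in> B'" by (cases s) auto
  obtain q0 q1 where q: "(q0, q1) \<in> B" "solves m a q0 q1"
    by (rule solution_exists[OF s(2)])
  then have "Phi (q0, q1) = s" using Phi_eq_iff s by simp
  then show "s \<in> Phi ` B" using q by blast
qed

theorem theorem1:
  shows "bij_betw Phi B B' \<and>
    continuous_map (subtopology seq_pair_topology B') (subtopology plane_topology B)
      (the_inv_into B Phi)"
proof
  show bij: "bij_betw Phi B B'" by (rule bij_betw_Phi)
  interpret Seq: Metric_space UNIV "max_dist seq_dist seq_dist"
    by (intro Metric_space_max_dist Metric_space_seq_dist)
  interpret Plane: Metric_space UNIV "max_dist dist dist :: real \<times> real \<Rightarrow> real \<times> real \<Rightarrow> real"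
    by (intro Metric_space_max_dist Met_TC.Metric_space_axioms)
  let ?f = "the_inv_into B Phi"
  have f: "?f s \<in> B" "Phi (?f s) = s" if "s \<in> B'" for s
    using that bij by (auto intro: bij_betwE[OF bij_betw_the_inv_into, rule_format] f_the_inv_into_f_bij_betw)
  have top: "topspace (subtopology seq_pair_topology B') = B'"
    by (simp add: seq_pair_topology_def)
  have "continuous_map (subtopology seq_pair_topology B') plane_topology ?f"
    unfolding plane_topology_def Plane.continuous_map_to_metric top
  proof (intro ballI allI impI)
    fix s and \<epsilon> :: real assume s: "s \<in> B'" and \<epsilon>: "0 < \<epsilon>"
    obtain m a q0 q1 where ma: "s = (m, a)" and q: "?f s = (q0, q1)" by (metis surj_pair)
    have B: "(q0, q1) \<in> B" and sol: "solves m a q0 q1"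
      using f[OF s, unfolded q, unfolded ma] Phi_eq_iff[of q0 q1 m a] by auto
    obtain N where N: "\<And>m' a' q0' q1'. \<forall>i<N. m' i = m i \<and> a' i = a i \<Longrightarrow> 1 < q0' \<Longrightarrow> 1 < q1' \<Longrightarrow>
        solves m' a' q0' q1' \<Longrightarrow> \<bar>q0' - q0\<bar> < \<epsilon> \<and> \<bar>q1' - q1\<bar> < \<epsilon>"
      using solution_stable[OF B_bounds(1,2)[OF B] sol _ \<epsilon>] s ma by blast
    let ?U = "Seq.mball s ((1 / 2) ^ N) \<inter> B'"
    show "\<exists>U. openin (subtopology seq_pair_topology B') U \<and> s \<in> U \<and> (\<forall>s'\<in>U. ?f s' \<in> Plane.mball (?f s) \<epsilon>)"
    proof (intro exI conjI ballI)
      show "openin (subtopology seq_pair_topology B') ?U"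
        unfolding seq_pair_topology_def by (intro openin_subtopology_Int Seq.openin_mball)
      show "s \<in> ?U" using s by simp
      fix s' assume s': "s' \<in> ?U"
      obtain m' a' q0' q1' where ma': "s' = (m', a')" and q': "?f s' = (q0', q1')" by (metis surj_pair)
      have B': "(q0', q1') \<in> B" and sol': "solves m' a' q0' q1'"
        using f[of s', unfolded q', unfolded ma'] s' Phi_eq_iff[of q0' q1' m' a'] ma' by auto
      have dist: "max_dist seq_dist seq_dist s s' < (1 / 2) ^ N" using s' by simp
      have "seq_dist m m' < (1 / 2) ^ N" "seq_dist a a' < (1 / 2) ^ N"
        using dist by (auto simp: ma ma' max_dist_def)
      then have "\<forall>i<N. m' i = m i \<and> a' i = a i"
        using seq_dist_less_imp_eq by metis
      then have "\<bar>q0' - q0\<bar> < \<epsilon> \<and> \<bar>q1' - q1\<bar> < \<epsilon>"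
        using N B_bounds(1,2)[OF B'] sol' by blast
      then have "max_dist dist dist (?f s) (?f s') < \<epsilon>"
        by (simp add: q q' max_dist_def dist_real_def abs_minus_commute)
      then show "?f s' \<in> Plane.mball (?f s) \<epsilon>" by simp
    qed
  qed
  then show "continuous_map (subtopology seq_pair_topology B') (subtopology plane_topology B) ?f"
    using f(1) by (auto simp: continuous_map_in_subtopology top)
qed

end
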